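(* Let $M$ be a directed-complete effect monoid. Then there exists a convex directed-complete effect monoid $M_1$ and a complete Boolean algebra $M_2$ such that $M\cong M_1\oplus M_2$.
   Context: An effect algebra is a set $E$ with an element $0$, a partial binary operation $a+b$ (the partial sum), and a total complement $a\mapsto a^\perp$, such that: the sum is commutative and associative wherever defined, $a+0=a$, $a^\perp$ is the unique element with $a+a^\perp=1$ where $1:=0^\perp$, and $a+1$ defined implies $a=0$. The order is $a\le b$ iff $b=a+c$ for some $c$. An effect monoid is an effect algebra with an associative total multiplication $\cdot$ with unit $1$ which distributes over the partial sum on both sides. It is directed complete if every directed subset has a supremum. An effect algebra $E$ is convex if there is an action $[0,1]\times E\to E$, $(\lambda,a)\mapsto\lambda a$, with $\lambda(\mu a)=(\lambda\mu)a$; if $\lambda+\mu\le1$ then $\lambda a+\mu a$ is defined and equals $(\lambda+\mu)a$; if $a+b$ is defined then $\lambda a+\lambda b$ is defined and equals $\lambda(a+b)$; and $1a=a$. A Boolean algebra is regarded as an effect monoid with $x+y$ defined iff $x\wedge y=0$ (then equal to $x\vee y$) and product $x\wedge y$. The direct sum $\oplus$ is the Cartesian product with componentwise operations; $\cong$ is isomorphism of effect monoids. *)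

theory Defs
  imports Complex_Main "HOL-Algebra.Complete_Lattice"
begin

(* The partial sum is a total function eplus together with its domain of definition orth;
   the values of eplus outside that domain, and of all operations outside the carrier, are
   irrelevant. *)
record 'a effect_algebra = "'a partial_object" +
  ezero :: "'a" ("\<zero>\<index>")
  orth  :: "'a \<Rightarrow> 'a \<Rightarrow> bool" (infix "\<perp>\<index>" 50)
  eplus :: "'a \<Rightarrow> 'a \<Rightarrow> 'a" (infixl "\<oplus>\<index>" 65)
  ecompl :: "'a \<Rightarrow> 'a" ("\<sim>\<index> _" [81] 80)

definition eone :: "('a, 'm) effect_algebra_scheme \<Rightarrow> 'a" ("\<one>\<index>")
  where "\<one>\<^bsub>E\<^esub> = \<sim>\<^bsub>E\<^esub> \<zero>\<^bsub>E\<^esub>"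

locale effect_algebra =
  fixes E (structure)
  assumes zero_closed: "\<zero> \<in> carrier E"
    and plus_closed: "\<lbrakk>a \<in> carrier E; b \<in> carrier E; a \<perp> b\<rbrakk> \<Longrightarrow> a \<oplus> b \<in> carrier E"
    and compl_closed: "a \<in> carrier E \<Longrightarrow> \<sim> a \<in> carrier E"
    and orth_sym: "\<lbrakk>a \<in> carrier E; b \<in> carrier E; a \<perp> b\<rbrakk> \<Longrightarrow> b \<perp> a"
    and plus_commute: "\<lbrakk>a \<in> carrier E; b \<in> carrier E; a \<perp> b\<rbrakk> \<Longrightarrow> a \<oplus> b = b \<oplus> a"
    and orth_assoc:
      "\<lbrakk>a \<in> carrier E; b \<in> carrier E; c \<in> carrier E; a \<perp> b; a \<oplus> b \<perp> c\<rbrakk>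
        \<Longrightarrow> b \<perp> c \<and> a \<perp> b \<oplus> c"
    and plus_assoc:
      "\<lbrakk>a \<in> carrier E; b \<in> carrier E; c \<in> carrier E; a \<perp> b; a \<oplus> b \<perp> c\<rbrakk>
        \<Longrightarrow> (a \<oplus> b) \<oplus> c = a \<oplus> (b \<oplus> c)"
    and orth_zero: "a \<in> carrier E \<Longrightarrow> a \<perp> \<zero>"
    and plus_zero: "a \<in> carrier E \<Longrightarrow> a \<oplus> \<zero> = a"
    and orth_compl: "a \<in> carrier E \<Longrightarrow> a \<perp> \<sim> a"
    and plus_compl: "a \<in> carrier E \<Longrightarrow> a \<oplus> \<sim> a = \<one>"
    and compl_unique:
      "\<lbrakk>a \<in> carrier E; b \<in> carrier E; a \<perp> b; a \<oplus> b = \<one>\<rbrakk> \<Longrightarrow> b = \<sim> a"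
    and orth_one: "\<lbrakk>a \<in> carrier E; a \<perp> \<one>\<rbrakk> \<Longrightarrow> a = \<zero>"

definition effect_order :: "('a, 'm) effect_algebra_scheme \<Rightarrow> 'a gorder"
  where "effect_order E =
    \<lparr>carrier = carrier E, eq = (=),
     le = \<lambda>a b. \<exists>c\<in>carrier E. a \<perp>\<^bsub>E\<^esub> c \<and> b = a \<oplus>\<^bsub>E\<^esub> c\<rparr>"

definition directed_in :: "('a, 'm) gorder_scheme \<Rightarrow> 'a set \<Rightarrow> bool"
  where "directed_in L D \<longleftrightarrow>
    D \<subseteq> carrier L \<and> D \<noteq> {} \<and> (\<forall>x\<in>D. \<forall>y\<in>D. \<exists>z\<in>D. x \<sqsubseteq>\<^bsub>L\<^esub> z \<and> y \<sqsubseteq>\<^bsub>L\<^esub> z)"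

definition directed_complete :: "('a, 'm) effect_algebra_scheme \<Rightarrow> bool"
  where "directed_complete E \<longleftrightarrow>
    (\<forall>D. directed_in (effect_order E) D \<longrightarrow>
      (\<exists>s. least (effect_order E) s (Upper (effect_order E) D)))"

locale convex_action = effect_algebra +
  fixes act :: "real \<Rightarrow> 'a \<Rightarrow> 'a" (infixr "\<cdot>" 75)
  assumes act_closed: "\<lbrakk>r \<in> {0..1}; a \<in> carrier E\<rbrakk> \<Longrightarrow> r \<cdot> a \<in> carrier E"
    and act_act:
      "\<lbrakk>r \<in> {0..1}; s \<in> {0..1}; a \<in> carrier E\<rbrakk> \<Longrightarrow> r \<cdot> (s \<cdot> a) = (r * s) \<cdot> a"
    and act_add_left:
      "\<lbrakk>r \<in> {0..1}; s \<in> {0..1}; r + s \<le> 1; a \<in> carrier E\<rbrakk>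
        \<Longrightarrow> r \<cdot> a \<perp> s \<cdot> a \<and> (r \<cdot> a) \<oplus> (s \<cdot> a) = (r + s) \<cdot> a"
    and act_add_right:
      "\<lbrakk>r \<in> {0..1}; a \<in> carrier E; b \<in> carrier E; a \<perp> b\<rbrakk>
        \<Longrightarrow> r \<cdot> a \<perp> r \<cdot> b \<and> (r \<cdot> a) \<oplus> (r \<cdot> b) = r \<cdot> (a \<oplus> b)"
    and act_one: "a \<in> carrier E \<Longrightarrow> 1 \<cdot> a = a"

definition convex_effect_algebra :: "('a, 'm) effect_algebra_scheme \<Rightarrow> bool"
  where "convex_effect_algebra E \<longleftrightarrow> (\<exists>act. convex_action E act)"

record 'a effect_monoid = "'a effect_algebra" +
  emult :: "'a \<Rightarrow> 'a \<Rightarrow> 'a" (infixl "\<otimes>\<index>" 70)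

locale effect_monoid = effect_algebra M for M (structure) +
  assumes mult_closed: "\<lbrakk>a \<in> carrier M; b \<in> carrier M\<rbrakk> \<Longrightarrow> a \<otimes> b \<in> carrier M"
    and mult_assoc:
      "\<lbrakk>a \<in> carrier M; b \<in> carrier M; c \<in> carrier M\<rbrakk> \<Longrightarrow> (a \<otimes> b) \<otimes> c = a \<otimes> (b \<otimes> c)"
    and one_mult: "a \<in> carrier M \<Longrightarrow> \<one> \<otimes> a = a"
    and mult_one: "a \<in> carrier M \<Longrightarrow> a \<otimes> \<one> = a"
    and distrib_left:
      "\<lbrakk>a \<in> carrier M; b \<in> carrier M; c \<in> carrier M; b \<perp> c\<rbrakk>
        \<Longrightarrow> a \<otimes> b \<perp> a \<otimes> c \<and> a \<otimes> (b \<oplus> c) = (a \<otimes> b) \<oplus> (a \<otimes> c)"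
    and distrib_right:
      "\<lbrakk>a \<in> carrier M; b \<in> carrier M; c \<in> carrier M; b \<perp> c\<rbrakk>
        \<Longrightarrow> b \<otimes> a \<perp> c \<otimes> a \<and> (b \<oplus> c) \<otimes> a = (b \<otimes> a) \<oplus> (c \<otimes> a)"

locale complete_boolean_algebra = complete_lattice +
  assumes meet_join_distrib:
      "\<lbrakk>x \<in> carrier L; y \<in> carrier L; z \<in> carrier L\<rbrakk>
        \<Longrightarrow> x \<sqinter> (y \<squnion> z) = (x \<sqinter> y) \<squnion> (x \<sqinter> z)"
    and complemented:
      "x \<in> carrier L \<Longrightarrow> \<exists>y\<in>carrier L. x \<sqinter> y = \<bottom> \<and> x \<squnion> y = \<top>"

definition boolean_effect_monoid :: "('a, 'm) gorder_scheme \<Rightarrow> 'a effect_monoid"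
  where "boolean_effect_monoid L =
    \<lparr>carrier = carrier L,
     ezero = \<bottom>\<^bsub>L\<^esub>,
     orth = \<lambda>x y. x \<sqinter>\<^bsub>L\<^esub> y = \<bottom>\<^bsub>L\<^esub>,
     eplus = \<lambda>x y. x \<squnion>\<^bsub>L\<^esub> y,
     ecompl = \<lambda>x. THE y. y \<in> carrier L \<and> x \<sqinter>\<^bsub>L\<^esub> y = \<bottom>\<^bsub>L\<^esub> \<and> x \<squnion>\<^bsub>L\<^esub> y = \<top>\<^bsub>L\<^esub>,
     emult = \<lambda>x y. x \<sqinter>\<^bsub>L\<^esub> y\<rparr>"

definition direct_sum ::
    "('a, 'm) effect_monoid_scheme \<Rightarrow> ('b, 'n) effect_monoid_scheme \<Rightarrow> ('a \<times> 'b) effect_monoid"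
    (infixr "\<oplus>\<oplus>" 65)
  where "M \<oplus>\<oplus> N =
    \<lparr>carrier = carrier M \<times> carrier N,
     ezero = (\<zero>\<^bsub>M\<^esub>, \<zero>\<^bsub>N\<^esub>),
     orth = \<lambda>(a, b) (c, d). a \<perp>\<^bsub>M\<^esub> c \<and> b \<perp>\<^bsub>N\<^esub> d,
     eplus = \<lambda>(a, b) (c, d). (a \<oplus>\<^bsub>M\<^esub> c, b \<oplus>\<^bsub>N\<^esub> d),
     ecompl = \<lambda>(a, b). (\<sim>\<^bsub>M\<^esub> a, \<sim>\<^bsub>N\<^esub> b),
     emult = \<lambda>(a, b) (c, d). (a \<otimes>\<^bsub>M\<^esub> c, b \<otimes>\<^bsub>N\<^esub> d)\<rparr>"

definition effect_monoid_iso ::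
    "('a, 'm) effect_monoid_scheme \<Rightarrow> ('b, 'n) effect_monoid_scheme \<Rightarrow> ('a \<Rightarrow> 'b) set"
  where "effect_monoid_iso M N =
    {f. bij_betw f (carrier M) (carrier N) \<and>
        f \<zero>\<^bsub>M\<^esub> = \<zero>\<^bsub>N\<^esub> \<and>
        (\<forall>a\<in>carrier M. f (\<sim>\<^bsub>M\<^esub> a) = \<sim>\<^bsub>N\<^esub> (f a)) \<and>
        (\<forall>a\<in>carrier M. \<forall>b\<in>carrier M. a \<perp>\<^bsub>M\<^esub> b \<longleftrightarrow> f a \<perp>\<^bsub>N\<^esub> f b) \<and>
        (\<forall>a\<in>carrier M. \<forall>b\<in>carrier M. a \<perp>\<^bsub>M\<^esub> b \<longrightarrow> f (a \<oplus>\<^bsub>M\<^esub> b) = f a \<oplus>\<^bsub>N\<^esub> f b) \<and>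
        (\<forall>a\<in>carrier M. \<forall>b\<in>carrier M. f (a \<otimes>\<^bsub>M\<^esub> b) = f a \<otimes>\<^bsub>N\<^esub> f b)}"

definition effect_monoid_isomorphic ::
    "('a, 'm) effect_monoid_scheme \<Rightarrow> ('b, 'n) effect_monoid_scheme \<Rightarrow> bool" (infix "\<cong>" 60)
  where "M \<cong> N \<longleftrightarrow> effect_monoid_iso M N \<noteq> {}"

end

(* An element h with h + h defined is called self-orthogonal here. Self-orthogonal elements form a
   directed set, because h + (2h)^perp k is self-orthogonal and lies above h and k. Let h be their
   supremum and p = 2h. As h + p^perp h is again self-orthogonal, p^perp h = 0, so p is idempotent,
   and M is the direct sum of the corners below p and below p^perp. The first corner has the half h
   of its unit, hence scalars for the dyadic rationals and, by directed suprema, for all of [0,1].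
   For a below p^perp, the element a a^perp is self-orthogonal, hence below h as well as below
   p^perp, hence zero: all elements of the second corner are idempotent, which makes it Boolean. *)

theory Submission
  imports Defs
begin

section \<open>Effect algebras\<close>

text \<open>Multiplication is neither assumed commutative nor assumed to preserve suprema, and
  nothing excludes infinitesimal elements beforehand. Three arguments close these gaps. Idempotents
  turn out to be central, so multiplication by \<open>p\<close> is a multiplicative projection onto
  the corner. Multiplication by a fixed element is additive and lies below the identity, and in a
  directed-complete effect algebra such a map preserves directed suprema; only thereby do real
  scalars multiply correctly. And an element below all powers of the half vanishes, which makes the
  scalar of 1 the unit. Idempotency of p comes from p^perp p = p^perp h + p^perp h = 0, since p = p
  p + p^perp p. The Boolean factor is given as an order, so the second corner still has to be
  compared with the effect monoid rebuilt from its lattice operations.\<close>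

abbreviation effect_le :: "('a, 'm) effect_algebra_scheme \<Rightarrow> 'a \<Rightarrow> 'a \<Rightarrow> bool"
    (infix "\<preceq>\<index>" 50)
  where "a \<preceq>\<^bsub>E\<^esub> b \<equiv> a \<sqsubseteq>\<^bsub>effect_order E\<^esub> b"

context effect_algebra begin

lemma le_iff: "a \<preceq> b \<longleftrightarrow> (\<exists>c\<in>carrier E. a \<perp> c \<and> b = a \<oplus> c)"
  by (simp add: effect_order_def)

lemma leE:
  assumes "a \<preceq> b"
  obtains c where "c \<in> carrier E" "a \<perp> c" "b = a \<oplus> c"
  using assms unfolding le_iff by blast

lemma carrier_effect_order [simp]: "carrier (effect_order E) = carrier E"
  by (simp add: effect_order_def)

lemma eq_effect_order [simp]: "(.=\<^bsub>effect_order E\<^esub>) = (=)"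
  by (simp add: effect_order_def)

declare zero_closed [simp, intro] compl_closed [simp, intro] plus_closed [simp, intro]
  orth_zero [simp] plus_zero [simp] orth_compl [simp] plus_compl [simp]

lemma one_closed [simp, intro]: "\<one> \<in> carrier E"
  by (simp add: eone_def)

lemma orth_commute: "\<lbrakk>a \<in> carrier E; b \<in> carrier E\<rbrakk> \<Longrightarrow> a \<perp> b \<longleftrightarrow> b \<perp> a"
  using orth_sym by blast

lemma zero_orth [simp]: "a \<in> carrier E \<Longrightarrow> \<zero> \<perp> a"
  using orth_commute by simp

lemma zero_plus [simp]: "a \<in> carrier E \<Longrightarrow> \<zero> \<oplus> a = a"
  using plus_commute zero_orth by simp

lemma compl_orth [simp]: "a \<in> carrier E \<Longrightarrow> \<sim> a \<perp> a"
  using orth_commute by simp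

lemma compl_plus [simp]: "a \<in> carrier E \<Longrightarrow> \<sim> a \<oplus> a = \<one>"
  using plus_commute compl_orth by (metis compl_closed plus_compl)

lemma compl_compl [simp]: "a \<in> carrier E \<Longrightarrow> \<sim> (\<sim> a) = a"
  using compl_unique by (metis compl_closed compl_orth compl_plus)

lemma compl_zero: "\<sim> \<zero> = \<one>"
  by (simp add: eone_def)

lemma compl_one [simp]: "\<sim> \<one> = \<zero>"
  by (simp add: eone_def)

text \<open>The axioms re-bracket from left to right only. Reversing the order of the summands,
  applying the axiom and reversing back gives the other direction.\<close>

lemma orth_assoc':
  assumes "a \<in> carrier E" "b \<in> carrier E" "c \<in> carrier E" "b \<perp> c" "a \<perp> b \<oplus> c"
  shows "a \<perp> b \<and> a \<oplus> b \<perp> c \<and> (a \<oplus> b) \<oplus> c = a \<oplus> (b \<oplus> c)"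
proof -
  have "c \<perp> b" "c \<oplus> b \<perp> a"
    using assms by (metis orth_sym plus_closed plus_commute)+
  then have "b \<perp> a \<and> c \<perp> b \<oplus> a"
    using assms orth_assoc by blast
  then have ab: "a \<perp> b" "a \<oplus> b \<perp> c"
    using assms by (metis orth_sym plus_closed plus_commute)+
  then show ?thesis
    using assms plus_assoc by blast
qed

text \<open>Re-bracketing \<open>(b \<oplus> a) \<oplus> \<sim> (a \<oplus> b) = \<one>\<close>
  exhibits \<open>a \<oplus> \<sim> (a \<oplus> b)\<close> as a complement of \<open>b\<close>, and
  complements are unique.\<close>

lemma compl_plus_eq:
  assumes "a \<in> carrier E" "b \<in> carrier E" "a \<perp> b"
  shows "\<sim> b = a \<oplus> \<sim> (a \<oplus> b) \<and> a \<perp> \<sim> (a \<oplus> b)"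
proof -
  let ?d = "\<sim> (a \<oplus> b)"
  have d: "?d \<in> carrier E" "b \<oplus> a \<perp> ?d" "(b \<oplus> a) \<oplus> ?d = \<one>" "b \<perp> a"
    using assms plus_commute[of a b] orth_sym[of a b] by auto
  then have "a \<perp> ?d" "b \<perp> a \<oplus> ?d" "b \<oplus> (a \<oplus> ?d) = \<one>"
    using assms orth_assoc[of b a ?d] plus_assoc[of b a ?d] by auto
  then show ?thesis
    using compl_unique[of b "a \<oplus> ?d"] assms d by auto
qed

text \<open>By \<open>compl_plus_eq\<close> the complement of \<open>b\<close> is determined by
  \<open>a\<close> and \<open>a \<oplus> b\<close> alone.\<close>

lemma plus_left_cancel:
  assumes "a \<in> carrier E" "b \<in> carrier E" "c \<in> carrier E" "a \<perp> b" "a \<perp> c" "a \<oplus> b = a \<oplus> c"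
  shows "b = c"
proof -
  have "\<sim> b = \<sim> c"
    using compl_plus_eq[of a b] compl_plus_eq[of a c] assms by simp
  then show ?thesis
    using assms compl_compl by metis
qed

lemma plus_eq_left_iff:
  assumes "a \<in> carrier E" "b \<in> carrier E" "a \<perp> b" "a \<oplus> b = a"
  shows "b = \<zero>"
  using plus_left_cancel[of a b \<zero>] assms by simp

text \<open>The sum is zero and hence orthogonal to \<open>\<one>\<close>; re-bracketing makes
  \<open>b\<close> orthogonal to \<open>\<one>\<close>, which forces
  \<open>b = \<zero>\<close>.\<close>

lemma plus_eq_zeroD:
  assumes "a \<in> carrier E" "b \<in> carrier E" "a \<perp> b" "a \<oplus> b = \<zero>"
  shows "a = \<zero>"
proof -
  have "a \<oplus> b \<perp> \<one>"
    using assms by simp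
  then have "b \<perp> \<one>"
    using orth_assoc assms one_closed by blast
  then have "b = \<zero>"
    using orth_one assms by blast
  then show ?thesis
    using assms by simp
qed

lemma le_refl [simp, intro]: "a \<in> carrier E \<Longrightarrow> a \<preceq> a"
  unfolding le_iff by (rule bexI[of _ \<zero>]) auto

lemma le_plus: "\<lbrakk>a \<in> carrier E; b \<in> carrier E; a \<perp> b\<rbrakk> \<Longrightarrow> a \<preceq> a \<oplus> b"
  unfolding le_iff by blast

lemma le_plus_right: "\<lbrakk>a \<in> carrier E; b \<in> carrier E; a \<perp> b\<rbrakk> \<Longrightarrow> b \<preceq> a \<oplus> b"
  using le_plus[of b a] plus_commute[of a b] orth_sym[of a b] by simp

lemma zero_le [simp, intro]: "a \<in> carrier E \<Longrightarrow> \<zero> \<preceq> a"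
  using le_plus[of \<zero> a] by simp

lemma le_one [simp, intro]: "a \<in> carrier E \<Longrightarrow> a \<preceq> \<one>"
  using le_plus[of a "\<sim> a"] by simp

lemma le_trans [trans]:
  assumes "a \<preceq> b" "b \<preceq> c" "a \<in> carrier E"
  shows "a \<preceq> c"
proof -
  obtain d where d: "d \<in> carrier E" "a \<perp> d" "b = a \<oplus> d"
    using assms(1) by (rule leE)
  obtain e where e: "e \<in> carrier E" "b \<perp> e" "c = b \<oplus> e"
    using assms(2) by (rule leE)
  have "d \<perp> e \<and> a \<perp> d \<oplus> e" "c = a \<oplus> (d \<oplus> e)"
    using orth_assoc[of a d e] plus_assoc[of a d e] assms d e by auto
  then show ?thesis
    using le_plus[of a "d \<oplus> e"] assms d e by auto
qed

lemma le_antisym: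
  assumes "a \<preceq> b" "b \<preceq> a" "a \<in> carrier E"
  shows "a = b"
proof -
  obtain d where d: "d \<in> carrier E" "a \<perp> d" "b = a \<oplus> d"
    using assms(1) by (rule leE)
  obtain e where e: "e \<in> carrier E" "a \<oplus> d \<perp> e" "(a \<oplus> d) \<oplus> e = a"
    using assms(2) d(3) by (metis leE)
  have "d \<perp> e" "a \<perp> d \<oplus> e" "a \<oplus> (d \<oplus> e) = a"
    using orth_assoc[of a d e] plus_assoc[of a d e] assms(3) d(1,2) e by auto
  then have "d \<oplus> e = \<zero>"
    using plus_eq_left_iff[of a "d \<oplus> e"] assms(3) d(1) e(1) by simp
  then have "d = \<zero>"
    using plus_eq_zeroD[of d e] d(1) e(1) \<open>d \<perp> e\<close> by simp
  then show ?thesis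
    using assms(3) d by simp
qed

lemma le_zeroD: "\<lbrakk>a \<preceq> \<zero>; a \<in> carrier E\<rbrakk> \<Longrightarrow> a = \<zero>"
  using le_antisym zero_le by blast

lemma orth_mono:
  assumes "a \<preceq> b" "b \<perp> c" "a \<in> carrier E" "c \<in> carrier E"
  shows "a \<perp> c" "a \<oplus> c \<preceq> b \<oplus> c"
proof -
  obtain d where d: "d \<in> carrier E" "a \<perp> d" "b = a \<oplus> d"
    using assms(1) by (rule leE)
  have b: "b = d \<oplus> a" "d \<perp> a" "d \<oplus> a \<perp> c"
    using d assms plus_commute orth_sym by auto
  then have *: "a \<perp> c \<and> d \<perp> a \<oplus> c" "b \<oplus> c = d \<oplus> (a \<oplus> c)"
    using orth_assoc[of d a c] plus_assoc[of d a c] assms d by auto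
  then show "a \<perp> c" "a \<oplus> c \<preceq> b \<oplus> c"
    using le_plus_right[of d "a \<oplus> c"] assms d by auto
qed

lemma plus_mono:
  assumes "a \<preceq> b" "c \<preceq> d" "b \<perp> d"
    "a \<in> carrier E" "b \<in> carrier E" "c \<in> carrier E" "d \<in> carrier E"
  shows "a \<perp> c" "a \<oplus> c \<preceq> b \<oplus> d"
proof -
  have 1: "a \<perp> d" "a \<oplus> d \<preceq> b \<oplus> d"
    using orth_mono assms by auto
  then have "d \<perp> a"
    using assms orth_sym by blast
  then have 2: "c \<perp> a" "c \<oplus> a \<preceq> d \<oplus> a"
    using orth_mono[of c d a] assms by auto
  show "a \<perp> c"
    using 2 assms orth_sym by blast
  then have "a \<oplus> c \<preceq> a \<oplus> d"
    using 1 2 assms by (simp add: plus_commute[of a])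
  then show "a \<oplus> c \<preceq> b \<oplus> d"
    using 1 le_trans assms \<open>a \<perp> c\<close> plus_closed by blast
qed

lemma orth_iff_le_compl:
  assumes "a \<in> carrier E" "b \<in> carrier E"
  shows "a \<perp> b \<longleftrightarrow> a \<preceq> \<sim> b"
proof
  assume "a \<perp> b"
  then show "a \<preceq> \<sim> b"
    using compl_plus_eq[of a b] le_plus[of a "\<sim> (a \<oplus> b)"] assms by auto
next
  assume "a \<preceq> \<sim> b"
  then show "a \<perp> b"
    using orth_mono(1)[of a "\<sim> b" b] assms by simp
qed

lemma compl_anti: "\<lbrakk>a \<preceq> b; a \<in> carrier E; b \<in> carrier E\<rbrakk> \<Longrightarrow> \<sim> b \<preceq> \<sim> a"
  using orth_iff_le_compl[of a "\<sim> b"] orth_iff_le_compl[of "\<sim> b" a] orth_commute by simp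

lemma plus_le_cancel:
  assumes "a \<perp> b" "a \<perp> c" "a \<oplus> b \<preceq> a \<oplus> c"
    "a \<in> carrier E" "b \<in> carrier E" "c \<in> carrier E"
  shows "b \<preceq> c"
proof -
  obtain d where d: "d \<in> carrier E" "a \<oplus> b \<perp> d" "a \<oplus> c = (a \<oplus> b) \<oplus> d"
    using assms(3) by (rule leE)
  then have *: "b \<perp> d" "a \<perp> b \<oplus> d" "a \<oplus> c = a \<oplus> (b \<oplus> d)"
    using orth_assoc[of a b d] plus_assoc[of a b d] assms by auto
  then have "c = b \<oplus> d"
    using plus_left_cancel[of a c "b \<oplus> d"] assms d by auto
  then show ?thesis
    using le_plus * assms d by auto
qed

text \<open>Every regrouping has to carry the definedness of the new sums along, so the summands are
  moved one bracket at a time.\<close>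

lemma plus_plus_commute:
  assumes "a \<in> carrier E" "b \<in> carrier E" "c \<in> carrier E" "d \<in> carrier E"
    "a \<perp> b" "c \<perp> d" "a \<oplus> b \<perp> c \<oplus> d"
  shows "a \<perp> c" "b \<perp> d" "a \<oplus> c \<perp> b \<oplus> d" "(a \<oplus> b) \<oplus> (c \<oplus> d) = (a \<oplus> c) \<oplus> (b \<oplus> d)"
proof -
  have 1: "b \<perp> c \<oplus> d" "a \<perp> b \<oplus> (c \<oplus> d)" "(a \<oplus> b) \<oplus> (c \<oplus> d) = a \<oplus> (b \<oplus> (c \<oplus> d))"
    using orth_assoc[of a b "c \<oplus> d"] plus_assoc[of a b "c \<oplus> d"] assms by auto
  have 2: "b \<perp> c" "b \<oplus> c \<perp> d" "b \<oplus> (c \<oplus> d) = (b \<oplus> c) \<oplus> d"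
    using orth_assoc'[of b c d] 1 assms by auto
  have 3: "c \<perp> b" "c \<oplus> b \<perp> d" "b \<oplus> (c \<oplus> d) = (c \<oplus> b) \<oplus> d"
    using 2 assms orth_sym[of b c] plus_commute[of b c] by auto
  have 4: "b \<perp> d" "c \<perp> b \<oplus> d" "b \<oplus> (c \<oplus> d) = c \<oplus> (b \<oplus> d)"
    using orth_assoc[of c b d] plus_assoc[of c b d] 3 assms by auto
  have "a \<perp> c" "a \<oplus> c \<perp> b \<oplus> d" "(a \<oplus> c) \<oplus> (b \<oplus> d) = a \<oplus> (c \<oplus> (b \<oplus> d))"
    using orth_assoc'[of a c "b \<oplus> d"] 1 4 assms by auto
  with 1 4 show "a \<perp> c" "b \<perp> d" "a \<oplus> c \<perp> b \<oplus> d" "(a \<oplus> b) \<oplus> (c \<oplus> d) = (a \<oplus> c) \<oplus> (b \<oplus> d)"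
    by auto
qed

section \<open>Suprema and their interaction with sums\<close>

definition is_sup :: "'a set \<Rightarrow> 'a \<Rightarrow> bool"
  where "is_sup D s \<longleftrightarrow>
    s \<in> carrier E \<and> (\<forall>x\<in>D. x \<preceq> s) \<and> (\<forall>u\<in>carrier E. (\<forall>x\<in>D. x \<preceq> u) \<longrightarrow> s \<preceq> u)"

lemma is_sup_closed: "is_sup D s \<Longrightarrow> s \<in> carrier E"
  and is_sup_upper: "\<lbrakk>is_sup D s; x \<in> D\<rbrakk> \<Longrightarrow> x \<preceq> s"
  and is_sup_least: "\<lbrakk>is_sup D s; u \<in> carrier E; \<And>x. x \<in> D \<Longrightarrow> x \<preceq> u\<rbrakk> \<Longrightarrow> s \<preceq> u"
  by (auto simp: is_sup_def)

lemma is_sup_iff_least: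
  assumes "D \<subseteq> carrier E"
  shows "is_sup D s \<longleftrightarrow> least (effect_order E) s (Upper (effect_order E) D)"
  using assms by (auto simp: is_sup_def least_def Upper_def subset_iff)

lemma ex_is_sup:
  assumes "directed_complete E" "D \<subseteq> carrier E" "D \<noteq> {}"
    and "\<And>x y. \<lbrakk>x \<in> D; y \<in> D\<rbrakk> \<Longrightarrow> \<exists>z\<in>D. x \<preceq> z \<and> y \<preceq> z"
  shows "\<exists>s. is_sup D s"
  using assms by (simp add: is_sup_iff_least directed_complete_def directed_in_def)

text \<open>The witness \<open>w\<close> is the difference \<open>u - x\<close>. It turns a bound on
  the sums \<open>x \<oplus> y\<close> into a bound on \<open>y\<close>, to which the leastness of a
  supremum applies.\<close>

lemma le_diff:
  assumes "x \<preceq> u" "x \<in> carrier E"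
  obtains w where "w \<in> carrier E" "\<And>y. y \<in> carrier E \<Longrightarrow> x \<perp> y \<and> x \<oplus> y \<preceq> u \<longleftrightarrow> y \<preceq> w"
proof -
  obtain w where w: "w \<in> carrier E" "x \<perp> w" "u = x \<oplus> w"
    using assms(1) by (rule leE)
  have "x \<perp> y \<and> x \<oplus> y \<preceq> u \<longleftrightarrow> y \<preceq> w" if y: "y \<in> carrier E" for y
  proof
    assume "x \<perp> y \<and> x \<oplus> y \<preceq> u"
    then show "y \<preceq> w"
      using plus_le_cancel[of x y w] w y assms by auto
  next
    assume "y \<preceq> w"
    then show "x \<perp> y \<and> x \<oplus> y \<preceq> u"
      using plus_mono[of x x y w] w y assms by auto
  qed
  with w that show ?thesis by blast
qed

text \<open>The variables are treated one after the other: for fixed \<open>x\<close> the difference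
  \<open>u - x\<close> bounds \<open>D'\<close> and hence \<open>t\<close>; then
  \<open>u - t\<close> bounds \<open>D\<close> and hence \<open>s\<close>.\<close>

lemma is_sup_plus_le:
  assumes D: "D \<subseteq> carrier E" "D \<noteq> {}" "is_sup D s"
    and D': "D' \<subseteq> carrier E" "D' \<noteq> {}" "is_sup D' t"
    and u: "u \<in> carrier E" and le: "\<And>x y. \<lbrakk>x \<in> D; y \<in> D'\<rbrakk> \<Longrightarrow> x \<perp> y \<and> x \<oplus> y \<preceq> u"
  shows "s \<perp> t \<and> s \<oplus> t \<preceq> u"
proof -
  have s: "s \<in> carrier E" and t: "t \<in> carrier E"
    using D D' is_sup_closed by auto
  have xu: "x \<preceq> u" if "x \<in> D" for x
  proof -
    obtain y where "y \<in> D'"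
      using D'(2) by blast
    then show ?thesis
      using le[OF that] le_plus[of x y] le_trans[of x "x \<oplus> y" u] that D(1) D'(1) by blast
  qed
  have *: "x \<perp> t \<and> x \<oplus> t \<preceq> u" if x: "x \<in> D" for x
  proof -
    have xE: "x \<in> carrier E"
      using x D by auto
    obtain w where w: "w \<in> carrier E" "\<And>y. y \<in> carrier E \<Longrightarrow> x \<perp> y \<and> x \<oplus> y \<preceq> u \<longleftrightarrow> y \<preceq> w"
      using le_diff[OF xu[OF x] xE] by blast
    have "t \<preceq> w"
      using is_sup_least[OF D'(3) w(1)] w(2) le x D'(1) by blast
    then show ?thesis
      using w(2) t by blast
  qed
  have "t \<preceq> u"
  proof -
    obtain x where "x \<in> D"
      using D(2) by blast
    then show ?thesis
      using * le_plus_right[of x t] le_trans[of t "x \<oplus> t" u] t D(1) by blast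
  qed
  then obtain w where w: "w \<in> carrier E" "\<And>y. y \<in> carrier E \<Longrightarrow> t \<perp> y \<and> t \<oplus> y \<preceq> u \<longleftrightarrow> y \<preceq> w"
    using le_diff[OF _ t] by blast
  have "s \<preceq> w"
  proof (rule is_sup_least[OF D(3) w(1)])
    fix x assume x: "x \<in> D"
    then have "t \<perp> x" "t \<oplus> x = x \<oplus> t"
      using *[OF x] D t orth_sym[of x t] plus_commute[of x t] by auto
    then show "x \<preceq> w"
      using w(2)[of x] *[OF x] D x by auto
  qed
  then have "t \<perp> s" "t \<oplus> s \<preceq> u"
    using w(2) s by auto
  then show ?thesis
    using s t orth_sym[of t s] plus_commute[of t s] by simp
qed

text \<open>If \<open>d\<close> is the gap between \<open>\<phi> s\<close> and the supremum of the \<open>\<phi> x\<close>, then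
  \<open>d \<preceq> \<phi> (s - x) \<preceq> s - x\<close> for all \<open>x\<close> in \<open>D\<close>, so that \<open>s - d\<close> is an upper bound of \<open>D\<close>.\<close>

lemma additive_deflation_sup_le:
  assumes dc: "directed_complete E"
    and D: "D \<subseteq> carrier E" "D \<noteq> {}" "\<And>x y. \<lbrakk>x \<in> D; y \<in> D\<rbrakk> \<Longrightarrow> \<exists>z\<in>D. x \<preceq> z \<and> y \<preceq> z"
    and s: "is_sup D s"
    and closed: "\<And>x. x \<in> carrier E \<Longrightarrow> \<phi> x \<in> carrier E"
    and additive: "\<And>x y. \<lbrakk>x \<in> carrier E; y \<in> carrier E; x \<perp> y\<rbrakk>
      \<Longrightarrow> \<phi> x \<perp> \<phi> y \<and> \<phi> (x \<oplus> y) = \<phi> x \<oplus> \<phi> y"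
    and deflation: "\<And>x. x \<in> carrier E \<Longrightarrow> \<phi> x \<preceq> x"
    and u: "u \<in> carrier E" "\<And>x. x \<in> D \<Longrightarrow> \<phi> x \<preceq> u"
  shows "\<phi> s \<preceq> u"
proof -
  have sE: "s \<in> carrier E"
    using s by (rule is_sup_closed)
  have mono: "\<phi> x \<preceq> \<phi> y" if "x \<preceq> y" "x \<in> carrier E" for x y
    using that(1) by (rule leE) (use additive closed le_plus that in auto)
  have "\<exists>w. is_sup (\<phi> ` D) w"
  proof (rule ex_is_sup[OF dc])
    fix x y assume "x \<in> \<phi> ` D" "y \<in> \<phi> ` D"
    then obtain x' y' where "x = \<phi> x'" "y = \<phi> y'" "x' \<in> D" "y' \<in> D"
      by auto
    moreover from this obtain z where "z \<in> D" "x' \<preceq> z" "y' \<preceq> z"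
      using D(3) by blast
    ultimately show "\<exists>z\<in>\<phi> ` D. x \<preceq> z \<and> y \<preceq> z"
      using mono D(1) by blast
  qed (use D closed in auto)
  then obtain w where w: "is_sup (\<phi> ` D) w"
    by blast
  have wE: "w \<in> carrier E"
    using w by (rule is_sup_closed)
  have "w \<preceq> \<phi> s"
    using is_sup_least[OF w closed[OF sE]] mono is_sup_upper[OF s] D(1) by auto
  then obtain d where d: "d \<in> carrier E" "w \<perp> d" "\<phi> s = w \<oplus> d"
    by (rule leE)
  have *: "x \<perp> d \<and> x \<oplus> d \<preceq> s" if x: "x \<in> D" for x
  proof -
    have xE: "x \<in> carrier E"
      using x D by auto
    obtain e where e: "e \<in> carrier E" "x \<perp> e" "s = x \<oplus> e"
      using is_sup_upper[OF s x] by (rule leE)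
    have 1: "\<phi> x \<perp> \<phi> e" "\<phi> s = \<phi> x \<oplus> \<phi> e"
      using additive e xE by auto
    have "\<phi> x \<preceq> w"
      using is_sup_upper[OF w] x by auto
    then have "\<phi> x \<perp> d" "\<phi> x \<oplus> d \<preceq> \<phi> s"
      using orth_mono[of "\<phi> x" w d] d closed xE by auto
    then have "d \<preceq> \<phi> e"
      using plus_le_cancel[of "\<phi> x" d "\<phi> e"] 1 d closed xE e by auto
    then have "d \<preceq> e"
      using deflation[OF e(1)] le_trans d by blast
    then show ?thesis
      using plus_mono[of x x d e] xE e d by auto
  qed
  have ds: "d \<preceq> s"
  proof -
    obtain x where "x \<in> D"
      using D(2) by blast
    then show ?thesis
      using * le_plus_right[of x d] le_trans[of d "x \<oplus> d" s] d D(1) by blast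
  qed
  then obtain v where v: "v \<in> carrier E" "d \<perp> v" "s = d \<oplus> v"
    by (rule leE)
  have "s \<preceq> v"
  proof (rule is_sup_least[OF s v(1)])
    fix x assume x: "x \<in> D"
    then have "d \<perp> x" "d \<oplus> x \<preceq> d \<oplus> v"
      using *[OF x] D d orth_sym[of x d] plus_commute[of x d] v by auto
    then show "x \<preceq> v"
      using plus_le_cancel[of d x v] x D d v by auto
  qed
  then have "s = v"
    using le_antisym[of s v] le_plus_right[of d v] v d sE by auto
  then have "d = \<zero>"
    using plus_eq_left_iff[of v d] v d orth_sym[of d v] plus_commute[of d v] by simp
  then have "\<phi> s = w"
    using d wE by simp
  then show ?thesis
    using is_sup_least[OF w u(1)] u(2) by auto
qed

end

section \<open>Effect monoids and their corners\<close>

context effect_monoid begin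

declare mult_closed [simp, intro] one_mult [simp] mult_one [simp]

lemma mult_zero [simp]: "a \<in> carrier M \<Longrightarrow> a \<otimes> \<zero> = \<zero>"
  using distrib_left[of a \<zero> \<zero>] plus_eq_left_iff[of "a \<otimes> \<zero>" "a \<otimes> \<zero>"]
  by (metis mult_closed orth_zero plus_zero zero_closed)

lemma zero_mult [simp]: "a \<in> carrier M \<Longrightarrow> \<zero> \<otimes> a = \<zero>"
  using distrib_right[of a \<zero> \<zero>] plus_eq_left_iff[of "\<zero> \<otimes> a" "\<zero> \<otimes> a"]
  by (metis mult_closed orth_zero plus_zero zero_closed)

lemma emult_mono:
  assumes "a \<preceq> b" "c \<preceq> d"
    "a \<in> carrier M" "b \<in> carrier M" "c \<in> carrier M" "d \<in> carrier M"
  shows "a \<otimes> c \<preceq> b \<otimes> d"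
proof -
  have "a \<otimes> c \<preceq> b \<otimes> c"
    using assms(1) by (rule leE) (use distrib_right le_plus assms in auto)
  moreover have "b \<otimes> c \<preceq> b \<otimes> d"
    using assms(2) by (rule leE) (use distrib_left le_plus assms in auto)
  ultimately show ?thesis
    using le_trans assms mult_closed by blast
qed

lemma mult_le_left: "\<lbrakk>a \<in> carrier M; b \<in> carrier M\<rbrakk> \<Longrightarrow> a \<otimes> b \<preceq> a"
  using emult_mono[of a a b \<one>] by simp

lemma mult_le_right: "\<lbrakk>a \<in> carrier M; b \<in> carrier M\<rbrakk> \<Longrightarrow> a \<otimes> b \<preceq> b"
  using emult_mono[of a \<one> b b] by simp

section \<open>Complements, idempotents and centrality\<close>

lemma mult_add_compl_left:
  assumes "p \<in> carrier M" "a \<in> carrier M"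
  shows "p \<otimes> a \<perp> \<sim> p \<otimes> a" "p \<otimes> a \<oplus> \<sim> p \<otimes> a = a"
  using distrib_right[of a p "\<sim> p"] assms by auto

lemma mult_add_compl_right:
  assumes "p \<in> carrier M" "a \<in> carrier M"
  shows "a \<otimes> p \<perp> a \<otimes> \<sim> p" "a \<otimes> p \<oplus> a \<otimes> \<sim> p = a"
  using distrib_left[of a p "\<sim> p"] assms by auto

text \<open>Both products are what remains of \<open>a\<close> when \<open>a \<otimes> a\<close> is
  taken away.\<close>

lemma mult_compl_commute:
  assumes "a \<in> carrier M"
  shows "a \<otimes> \<sim> a = \<sim> a \<otimes> a"
proof (rule plus_left_cancel)
  show "a \<otimes> a \<oplus> a \<otimes> \<sim> a = a \<otimes> a \<oplus> \<sim> a \<otimes> a"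
    using mult_add_compl_left(2)[of a a] mult_add_compl_right(2)[of a a] assms by simp
qed (use assms mult_add_compl_left mult_add_compl_right in auto)

lemma idem_iff:
  assumes "p \<in> carrier M"
  shows "p \<otimes> p = p \<longleftrightarrow> p \<otimes> \<sim> p = \<zero>"
proof
  assume "p \<otimes> p = p"
  then show "p \<otimes> \<sim> p = \<zero>"
    using mult_add_compl_right[of p p] plus_eq_left_iff[of p "p \<otimes> \<sim> p"] assms by simp
next
  assume "p \<otimes> \<sim> p = \<zero>"
  then show "p \<otimes> p = p"
    using mult_add_compl_right[of p p] assms by simp
qed

lemma idem_compl:
  assumes "p \<in> carrier M" "p \<otimes> p = p"
  shows "\<sim> p \<otimes> \<sim> p = \<sim> p"
  using assms idem_iff[of p] idem_iff[of "\<sim> p"] mult_compl_commute[of p] by simp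

text \<open>The mixed terms \<open>p \<otimes> a \<otimes> \<sim> p\<close> and
  \<open>\<sim> p \<otimes> a \<otimes> p\<close> lie below \<open>p \<otimes> \<sim> p\<close> and
  \<open>\<sim> p \<otimes> p\<close>, which are zero. So \<open>p \<otimes> a\<close> and
  \<open>a \<otimes> p\<close> both equal \<open>p \<otimes> a \<otimes> p\<close>.\<close>

lemma idem_commute:
  assumes p: "p \<in> carrier M" "p \<otimes> p = p" and a: "a \<in> carrier M"
  shows "p \<otimes> a = a \<otimes> p"
proof -
  have 0: "p \<otimes> \<sim> p = \<zero>" "\<sim> p \<otimes> p = \<zero>"
    using p idem_iff mult_compl_commute[of p] by auto
  have "p \<otimes> (a \<otimes> \<sim> p) \<preceq> p \<otimes> \<sim> p"
    using emult_mono[of p p "a \<otimes> \<sim> p" "\<sim> p"] mult_le_right p a by simp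
  then have 1: "(p \<otimes> a) \<otimes> \<sim> p = \<zero>"
    using 0 p a by (simp add: mult_assoc le_zeroD)
  have "(\<sim> p \<otimes> a) \<otimes> p \<preceq> \<sim> p \<otimes> p"
    using emult_mono[of "\<sim> p \<otimes> a" "\<sim> p" p p] mult_le_left p a by simp
  then have 2: "\<sim> p \<otimes> (a \<otimes> p) = \<zero>"
    using 0 p a by (simp add: mult_assoc[symmetric] le_zeroD)
  have "p \<otimes> a = (p \<otimes> a) \<otimes> p"
    using mult_add_compl_right(2)[of p "p \<otimes> a"] 1 p a by simp
  also have "\<dots> = a \<otimes> p"
    using mult_add_compl_left(2)[of p "a \<otimes> p"] 2 p a by (simp add: mult_assoc)
  finally show ?thesis .
qed

text \<open>Below an idempotent the order becomes an equation, and equations pass through sums by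
  distributivity; this is what makes corners closed under addition.\<close>

lemma le_idem_iff:
  assumes "p \<in> carrier M" "p \<otimes> p = p" "a \<in> carrier M"
  shows "a \<preceq> p \<longleftrightarrow> p \<otimes> a = a"
proof
  assume "a \<preceq> p"
  then have "\<sim> p \<otimes> a \<preceq> \<sim> p \<otimes> p"
    using emult_mono[of "\<sim> p" "\<sim> p" a p] assms by simp
  then have "\<sim> p \<otimes> a = \<zero>"
    using assms idem_iff mult_compl_commute[of p] le_zeroD by simp
  then show "p \<otimes> a = a"
    using mult_add_compl_left(2)[of p a] assms by simp
next
  assume "p \<otimes> a = a"
  then show "a \<preceq> p"
    using mult_le_left[of p a] assms by simp
qed

text \<open>The element \<open>h + (2h)\<^sup>\<bottom>k\<close> lies above \<open>k\<close> because \<open>(2h)k = h(2k) \<preceq> h\<close>.\<close>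

lemma self_orth_directed:
  assumes "h \<in> carrier M" "k \<in> carrier M" "h \<perp> h" "k \<perp> k"
  obtains l where "l \<in> carrier M" "l \<perp> l" "h \<preceq> l" "k \<preceq> l" "l = h \<oplus> \<sim> (h \<oplus> h) \<otimes> k"
    "h \<perp> \<sim> (h \<oplus> h) \<otimes> k"
proof -
  let ?q = "\<sim> (h \<oplus> h)"
  let ?r = "?q \<otimes> k"
  have c: "h \<oplus> h \<in> carrier M" "k \<oplus> k \<in> carrier M" "?q \<in> carrier M" "?r \<in> carrier M"
    using assms by auto
  have r: "?r \<perp> ?r" "?r \<oplus> ?r = ?q \<otimes> (k \<oplus> k)"
    using distrib_left[of ?q k k] assms c by auto
  \<comment> \<open>Self-orthogonality of \<open>h \<oplus> ?r\<close>: the double of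
    \<open>?r\<close> is a multiple of \<open>?q\<close> and so fits beside
    \<open>h \<oplus> h\<close>; the four summands are then regrouped.\<close>
  have "?r \<oplus> ?r \<perp> h \<oplus> h"
    using mult_le_left[OF c(3,2)] r(2) c by (simp add: orth_iff_le_compl)
  then have "h \<oplus> h \<perp> ?r \<oplus> ?r"
    using orth_sym[of "?r \<oplus> ?r" "h \<oplus> h"] r(1) c by simp
  then have hr: "h \<perp> ?r" "h \<oplus> ?r \<perp> h \<oplus> ?r"
    using plus_plus_commute[of h h ?r ?r] assms r c by auto
  have "(h \<oplus> h) \<otimes> k = h \<otimes> (k \<oplus> k)"
    using distrib_right[of k h h] distrib_left[of h k k] assms by auto
  then have "(h \<oplus> h) \<otimes> k \<preceq> h"
    using mult_le_left[of h "k \<oplus> k"] assms by auto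
  then have "(h \<oplus> h) \<otimes> k \<oplus> ?r \<preceq> h \<oplus> ?r"
    using orth_mono[of "(h \<oplus> h) \<otimes> k" h ?r] hr assms c by auto
  then have "k \<preceq> h \<oplus> ?r"
    using mult_add_compl_left[of "h \<oplus> h" k] assms c by simp
  then show ?thesis
    using that[of "h \<oplus> ?r"] hr le_plus[of h ?r] assms c by auto
qed

lemma greatest_self_orth:
  assumes dc: "directed_complete M"
  obtains h where "h \<in> carrier M" "h \<perp> h" "(h \<oplus> h) \<otimes> (h \<oplus> h) = h \<oplus> h"
    "\<And>k. \<lbrakk>k \<in> carrier M; k \<perp> k\<rbrakk> \<Longrightarrow> k \<preceq> h"
proof -
  define T where "T = {k \<in> carrier M. k \<perp> k}"
  have T: "T \<subseteq> carrier M" "T \<noteq> {}"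
    by (auto simp: T_def intro!: exI[of _ \<zero>])
  have directed: "\<exists>l\<in>T. h \<preceq> l \<and> k \<preceq> l" if "h \<in> T" "k \<in> T" for h k
    using that self_orth_directed[of h k] unfolding T_def by blast
  then obtain s where s: "is_sup T s"
    using ex_is_sup[OF dc T] by blast
  have sM: "s \<in> carrier M"
    using s by (rule is_sup_closed)
  \<comment> \<open>Any two members lie below a common self-orthogonal one and are therefore
    orthogonal. Summing over pairs, not only over \<open>h \<oplus> h\<close>, is what
    \<open>is_sup_plus_le\<close> asks for.\<close>
  have "h \<perp> k" if hk: "h \<in> T" "k \<in> T" for h k
  proof -
    obtain l where "l \<in> T" "h \<preceq> l" "k \<preceq> l"
      using directed hk by blast
    then show ?thesis
      using plus_mono(1)[of h l k l] hk by (auto simp: T_def)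
  qed
  then have ss: "s \<perp> s"
    using is_sup_plus_le[OF T s T s one_closed] T(1) by (meson in_mono le_one plus_closed)
  obtain l where l: "l \<in> carrier M" "l \<perp> l" "l = s \<oplus> \<sim> (s \<oplus> s) \<otimes> s" "s \<perp> \<sim> (s \<oplus> s) \<otimes> s" "s \<preceq> l"
    using self_orth_directed[of s s] sM ss by blast
  then have "l = s"
    using is_sup_upper[OF s, of l] le_antisym by (auto simp: T_def)
  then have 0: "\<sim> (s \<oplus> s) \<otimes> s = \<zero>"
    using plus_eq_left_iff[of s "\<sim> (s \<oplus> s) \<otimes> s"] l sM ss by auto
  then have "\<sim> (s \<oplus> s) \<otimes> (s \<oplus> s) = \<zero>"
    using distrib_left[of "\<sim> (s \<oplus> s)" s s] sM ss by auto
  then have "(s \<oplus> s) \<otimes> (s \<oplus> s) = s \<oplus> s"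
    using idem_iff[of "s \<oplus> s"] mult_compl_commute[of "s \<oplus> s"] sM ss by auto
  then show ?thesis
    using that sM ss is_sup_upper[OF s] by (auto simp: T_def)
qed

end

text \<open>For idempotent \<open>p\<close> and \<open>a\<close> below it,
  \<open>p \<otimes> \<sim> a\<close> is the difference \<open>p - a\<close>, because
  \<open>p = p \<otimes> a \<oplus> p \<otimes> \<sim> a\<close> and
  \<open>p \<otimes> a = a\<close>. Orthogonality can be inherited unchanged since sums of elements
  below an idempotent stay below it.\<close>

definition corner :: "('a, 'm) effect_monoid_scheme \<Rightarrow> 'a \<Rightarrow> 'a effect_monoid"
  where "corner M p =
    \<lparr>carrier = {a \<in> carrier M. a \<preceq>\<^bsub>M\<^esub> p},
     ezero = \<zero>\<^bsub>M\<^esub>,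
     orth = orth M,
     eplus = eplus M,
     ecompl = \<lambda>a. p \<otimes>\<^bsub>M\<^esub> (\<sim>\<^bsub>M\<^esub> a),
     emult = emult M\<rparr>"

lemma corner_simps [simp]:
  "carrier (corner M p) = {a \<in> carrier M. a \<preceq>\<^bsub>M\<^esub> p}"
  "\<zero>\<^bsub>corner M p\<^esub> = \<zero>\<^bsub>M\<^esub>"
  "orth (corner M p) = orth M"
  "eplus (corner M p) = eplus M"
  "ecompl (corner M p) = (\<lambda>a. p \<otimes>\<^bsub>M\<^esub> (\<sim>\<^bsub>M\<^esub> a))"
  "emult (corner M p) = emult M"
  by (simp_all add: corner_def)

context effect_monoid begin

lemma corner_one: "p \<in> carrier M \<Longrightarrow> \<one>\<^bsub>corner M p\<^esub> = p"
  by (simp add: eone_def[of "corner M p"] compl_zero)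

lemma plus_le_idem:
  assumes "p \<in> carrier M" "p \<otimes> p = p" "a \<preceq> p" "b \<preceq> p" "a \<in> carrier M" "b \<in> carrier M" "a \<perp> b"
  shows "a \<oplus> b \<preceq> p"
  using assms distrib_left[of p a b] le_idem_iff[of p] by simp

text \<open>The difference witnessing \<open>a \<preceq> b\<close> lies below \<open>b\<close>,
  hence below \<open>p\<close>, so it is available in the corner as well.\<close>

lemma corner_le_iff:
  assumes "p \<in> carrier M" "a \<in> carrier M" "b \<in> carrier M" "b \<preceq> p"
  shows "a \<preceq>\<^bsub>corner M p\<^esub> b \<longleftrightarrow> a \<preceq> b"
proof
  assume "a \<preceq> b"
  then obtain c where c: "c \<in> carrier M" "a \<perp> c" "b = a \<oplus> c"
    by (rule leE)
  moreover have "c \<preceq> p"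
    using le_trans[of c b p] le_plus_right[of a c] assms c by simp
  ultimately show "a \<preceq>\<^bsub>corner M p\<^esub> b"
    by (auto simp: effect_order_def[of "corner M p"])
next
  assume "a \<preceq>\<^bsub>corner M p\<^esub> b"
  then show "a \<preceq> b"
    by (auto simp: effect_order_def)
qed

lemma effect_monoid_corner:
  assumes p: "p \<in> carrier M" "p \<otimes> p = p"
  shows "effect_monoid (corner M p)"
proof -
  note [simp] = corner_one[OF p(1)]
  have compl: "a \<perp> p \<otimes> \<sim> a \<and> a \<oplus> p \<otimes> \<sim> a = p" if "a \<in> carrier M" "a \<preceq> p" for a
    using that p mult_add_compl_right[of a p] le_idem_iff[of p a] by auto
  show ?thesis
  proof (unfold_locales; simp)
    fix a b assume ab: "a \<in> carrier M \<and> a \<preceq> p" "b \<in> carrier M \<and> b \<preceq> p"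
    {
      assume "a \<perp> b"
      then show "a \<oplus> b \<preceq> p" "b \<perp> a" "a \<oplus> b = b \<oplus> a"
        using ab p plus_le_idem orth_sym plus_commute by auto
    }
    show "a \<otimes> b \<preceq> p"
      using ab p mult_le_left[of a b] le_trans by auto
    {
      assume "a \<perp> b" "a \<oplus> b = p"
      then show "b = p \<otimes> \<sim> a"
        using compl[of a] ab p plus_left_cancel[of a b "p \<otimes> \<sim> a"] by simp
    }
  next
    fix a assume "a \<in> carrier M \<and> a \<preceq> p"
    then show "p \<otimes> \<sim> a \<in> carrier M \<and> p \<otimes> \<sim> a \<preceq> p"
      and "a \<perp> p \<otimes> \<sim> a" "a \<oplus> p \<otimes> \<sim> a = p" "p \<otimes> a = a" "a \<otimes> p = a"
      using compl[of a] p mult_le_left[of p "\<sim> a"] le_idem_iff[of p a] idem_commute[of p a] by auto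
  next
    fix a assume a: "a \<in> carrier M \<and> a \<preceq> p" "a \<perp> p"
    \<comment> \<open>The sum cannot leave the corner, so adding \<open>a\<close> to
      \<open>p\<close> changes nothing and cancellation gives \<open>a = \<zero>\<close>.\<close>
    then have "a \<oplus> p \<preceq> p"
      using plus_le_idem[of p a p] p by simp
    then have "p \<oplus> a = p"
      using a p le_antisym[of "p \<oplus> a" p] le_plus[of p a] orth_sym[of a p] plus_commute[of a p] by simp
    then show "a = \<zero>"
      using plus_eq_left_iff[of p a] a p orth_sym by blast
  qed ((rule zero_le orth_assoc plus_assoc mult_assoc distrib_left distrib_right; simp add: p)+)
qed

text \<open>Since \<open>p\<close> bounds every subset of the corner, the supremum formed in
  \<open>M\<close> already lies in the corner.\<close>

lemma directed_complete_corner: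
  assumes dc: "directed_complete M" and p: "p \<in> carrier M" "p \<otimes> p = p"
  shows "directed_complete (corner M p)"
proof -
  interpret C: effect_monoid "corner M p"
    using p by (rule effect_monoid_corner)
  have le: "a \<preceq>\<^bsub>corner M p\<^esub> b \<longleftrightarrow> a \<preceq> b"
    if "a \<in> carrier (corner M p)" "b \<in> carrier (corner M p)" for a b
    using that p corner_le_iff by simp
  show ?thesis
    unfolding directed_complete_def
  proof (intro allI impI)
    fix D assume D: "directed_in (effect_order (corner M p)) D"
    then have DC: "D \<subseteq> carrier (corner M p)"
      by (simp add: directed_in_def)
    have "\<exists>s. is_sup D s"
    proof (rule ex_is_sup[OF dc])
      fix x y assume xy: "x \<in> D" "y \<in> D"
      then obtain z where "z \<in> D" "x \<preceq>\<^bsub>corner M p\<^esub> z" "y \<preceq>\<^bsub>corner M p\<^esub> z"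
        using D unfolding directed_in_def by blast
      then show "\<exists>z\<in>D. x \<preceq> z \<and> y \<preceq> z"
        using le xy DC by blast
    qed (use D in \<open>auto simp: directed_in_def\<close>)
    then obtain s where s: "is_sup D s"
      by blast
    have sC: "s \<in> carrier (corner M p)"
      using is_sup_closed[OF s] is_sup_least[OF s p(1)] DC by auto
    have "C.is_sup D s"
      unfolding C.is_sup_def
    proof (intro conjI ballI impI)
      fix x assume "x \<in> D"
      then show "x \<preceq>\<^bsub>corner M p\<^esub> s"
        using le[OF _ sC] is_sup_upper[OF s] DC by blast
    next
      fix u assume u: "u \<in> carrier (corner M p)" "\<forall>x\<in>D. x \<preceq>\<^bsub>corner M p\<^esub> u"
      then have "x \<preceq> u" if "x \<in> D" for x
        using that le[OF _ u(1)] DC by blast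
      then have "s \<preceq> u"
        using is_sup_least[OF s] u(1) by simp
      then show "s \<preceq>\<^bsub>corner M p\<^esub> u"
        using le[OF sC u(1)] by simp
    qed (rule sC)
    then show "\<exists>s. least (effect_order (corner M p)) s (Upper (effect_order (corner M p)) D)"
      using C.is_sup_iff_least[OF DC] by blast
  qed
qed

end

section \<open>Convexity from a half of the unit\<close>

text \<open>Meant for \<open>t = 2 ^ N\<close>, \<open>u = r * t\<close>, \<open>v = s * t\<close>
  and \<open>w = r * s * t\<close>: lowering both factors by 1 costs the product at most
  \<open>u + v\<close>, hence at most \<open>2 * t\<close>.\<close>

lemma approx_mult:
  fixes u v w t c :: real
  assumes "(u - 1) * (v - 1) \<le> c" "u \<le> t" "v \<le> t" "w * t = u * v"
  shows "(w - 2) * t \<le> c"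
proof -
  have "(w - 2) * t = (u - 1) * (v - 1) + (u - t) + (v - t) - 1"
    using assms(4) by (simp add: algebra_simps)
  then show ?thesis
    using assms by linarith
qed

context effect_algebra begin

text \<open>A value of \<open>multiple\<close> is meaningful only where \<open>has_multiple\<close> holds.\<close>

primrec multiple :: "nat \<Rightarrow> 'a \<Rightarrow> 'a"
  where "multiple 0 x = \<zero>"
    | "multiple (Suc k) x = multiple k x \<oplus> x"

primrec has_multiple :: "nat \<Rightarrow> 'a \<Rightarrow> bool"
  where "has_multiple 0 x \<longleftrightarrow> True"
    | "has_multiple (Suc k) x \<longleftrightarrow> has_multiple k x \<and> multiple k x \<perp> x"

lemma multiple_closed [simp]:
  "\<lbrakk>x \<in> carrier E; has_multiple k x\<rbrakk> \<Longrightarrow> multiple k x \<in> carrier E"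
  by (induction k) auto

lemma multiple_add:
  assumes "x \<in> carrier E" "has_multiple (k + l) x"
  shows "has_multiple k x \<and> has_multiple l x \<and> multiple k x \<perp> multiple l x \<and>
    multiple (k + l) x = multiple k x \<oplus> multiple l x"
  using assms(2)
proof (induction l)
  case (Suc l)
  then show ?case
    using orth_assoc[of "multiple k x" "multiple l x" x]
      plus_assoc[of "multiple k x" "multiple l x" x] assms(1) by auto
qed (use assms in auto)

text \<open>Copies of \<open>x\<close> are detached from the second multiple one at a time, by
  re-bracketing to the left.\<close>

lemma has_multiple_add:
  assumes "x \<in> carrier E" "has_multiple k x" "has_multiple l x" "multiple k x \<perp> multiple l x"
  shows "has_multiple (k + l) x"
  using assms(3,4)
proof (induction l)
  case (Suc l)
  then have *: "multiple k x \<perp> multiple l x" "multiple k x \<oplus> multiple l x \<perp> x"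
    using orth_assoc'[of "multiple k x" "multiple l x" x] assms(1,2) by auto
  then have "has_multiple (k + l) x"
    using Suc by simp
  then show ?case
    using * multiple_add[of x k l] assms(1) by simp
qed (use assms in auto)

lemma has_multiple_mono: "\<lbrakk>has_multiple l x; k \<le> l; x \<in> carrier E\<rbrakk> \<Longrightarrow> has_multiple k x"
  using multiple_add[of x k "l - k"] by simp

lemma multiple_mono:
  "\<lbrakk>has_multiple l x; k \<le> l; x \<in> carrier E\<rbrakk> \<Longrightarrow> multiple k x \<preceq> multiple l x"
  using multiple_add[of x k "l - k"] le_plus by simp

lemma multiple_multiple:
  assumes "x \<in> carrier E" "has_multiple l x" "has_multiple k (multiple l x)"
  shows "has_multiple (k * l) x \<and> multiple (k * l) x = multiple k (multiple l x)"
  using assms(3)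
proof (induction k)
  case (Suc k)
  then have "has_multiple (k * l + l) x"
    using has_multiple_add[of x "k * l" l] assms(1,2) by simp
  then show ?case
    using multiple_add[of x "k * l" l] assms(1) Suc by (simp add: add.commute)
qed simp

end

context effect_monoid begin

lemma mult_multiple:
  assumes "a \<in> carrier M" "x \<in> carrier M" "has_multiple k x"
  shows "has_multiple k (a \<otimes> x) \<and> a \<otimes> multiple k x = multiple k (a \<otimes> x)"
  using assms(3)
proof (induction k)
  case (Suc k)
  then show ?case
    using distrib_left[of a "multiple k x" x] assms(1,2) by auto
qed (use assms in simp)

lemma multiple_mult:
  assumes "a \<in> carrier M" "x \<in> carrier M" "has_multiple k x"
  shows "has_multiple k (x \<otimes> a) \<and> multiple k x \<otimes> a = multiple k (x \<otimes> a)"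
  using assms(3)
proof (induction k)
  case (Suc k)
  then show ?case
    using distrib_right[of a "multiple k x" x] assms(1,2) by auto
qed (use assms in simp)

end

locale halvable_effect_monoid = effect_monoid +
  fixes half :: 'a
  assumes half_closed [simp]: "half \<in> carrier M"
    and half_orth: "half \<perp> half"
    and half_plus_half: "half \<oplus> half = \<one>"
    and complete: "directed_complete M"
begin

section \<open>Dyadic fractions of the unit\<close>

primrec half_pow :: "nat \<Rightarrow> 'a"
  where "half_pow 0 = \<one>"
    | "half_pow (Suc n) = half \<otimes> half_pow n"

text \<open>Stands for the fraction \<open>k / 2 ^ n\<close> of the unit. The multiple is known to
  exist only for \<open>k \<le> 2 ^ n\<close>, a bound that the lemmas below keep assuming.\<close>

definition dyadic :: "nat \<Rightarrow> nat \<Rightarrow> 'a"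
  where "dyadic k n = multiple k (half_pow n)"

lemma half_pow_closed [simp]: "half_pow n \<in> carrier M"
  by (induction n) auto

lemma half_pow_add: "half_pow (n + m) = half_pow n \<otimes> half_pow m"
  by (induction n) (auto simp: mult_assoc)

lemma half_pow_Suc_plus:
  "half_pow (Suc n) \<perp> half_pow (Suc n) \<and> half_pow (Suc n) \<oplus> half_pow (Suc n) = half_pow n"
  using distrib_right[of "half_pow n" half half] half_orth half_plus_half by simp

lemma multiple_pow_half_pow: "has_multiple (2 ^ n) (half_pow n) \<and> multiple (2 ^ n) (half_pow n) = \<one>"
proof (induction n)
  case (Suc n)
  have "has_multiple 2 (half_pow (Suc n)) \<and> multiple 2 (half_pow (Suc n)) = half_pow n"
    using half_pow_Suc_plus[of n] by (simp add: numeral_2_eq_2)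
  then show ?case
    using multiple_multiple[of "half_pow (Suc n)" 2 "2 ^ n"] Suc half_pow_closed[of "Suc n"]
    by (simp add: mult.commute)
qed simp

lemma has_multiple_half_pow [simp]: "k \<le> 2 ^ n \<Longrightarrow> has_multiple k (half_pow n)"
  using has_multiple_mono[of "2 ^ n" "half_pow n" k] multiple_pow_half_pow[of n] by simp

lemma dyadic_closed [simp]: "k \<le> 2 ^ n \<Longrightarrow> dyadic k n \<in> carrier M"
  by (simp add: dyadic_def)

lemma dyadic_zero [simp]: "dyadic 0 n = \<zero>"
  by (simp add: dyadic_def)

text \<open>Each \<open>half_pow n\<close> consists of \<open>2 ^ m\<close> copies of
  \<open>half_pow (n + m)\<close>. This brings two fractions to a common denominator.\<close>

lemma dyadic_refine:
  assumes "k \<le> 2 ^ n"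
  shows "dyadic (k * 2 ^ m) (n + m) = dyadic k n"
proof -
  have "has_multiple (2 ^ m) (half_pow (n + m)) \<and> multiple (2 ^ m) (half_pow (n + m)) = half_pow n"
    using mult_multiple[of "half_pow n" "half_pow m" "2 ^ m"] multiple_pow_half_pow[of m]
    by (simp add: half_pow_add)
  then show ?thesis
    using multiple_multiple[of "half_pow (n + m)" "2 ^ m" k] assms by (simp add: dyadic_def)
qed

lemma dyadic_le:
  assumes "k \<le> 2 ^ n" "l \<le> 2 ^ m" "k * 2 ^ m \<le> l * 2 ^ n"
  shows "dyadic k n \<preceq> dyadic l m"
proof -
  have "l * 2 ^ n \<le> 2 ^ (n + m)"
    using assms(2) by (simp add: power_add)
  then have "dyadic (k * 2 ^ m) (n + m) \<preceq> dyadic (l * 2 ^ n) (n + m)"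
    unfolding dyadic_def using assms(3) by (intro multiple_mono) auto
  then show ?thesis
    using dyadic_refine[of k n m] dyadic_refine[of l m n] assms by (simp add: add.commute)
qed

lemma dyadic_plus:
  assumes "k + l \<le> 2 ^ n"
  shows "dyadic k n \<perp> dyadic l n \<and> dyadic k n \<oplus> dyadic l n = dyadic (k + l) n"
  using multiple_add[of "half_pow n" k l] assms by (simp add: dyadic_def)

lemma dyadic_mult:
  assumes "k \<le> 2 ^ n" "l \<le> 2 ^ m"
  shows "dyadic k n \<otimes> dyadic l m = dyadic (k * l) (n + m)"
proof -
  let ?x = "half_pow n" and ?y = "half_pow m"
  have 1: "has_multiple l (?x \<otimes> ?y)" "?x \<otimes> multiple l ?y = multiple l (?x \<otimes> ?y)"
    using mult_multiple[of ?x ?y l] assms by auto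
  have 2: "has_multiple k (?x \<otimes> multiple l ?y)"
    "multiple k ?x \<otimes> multiple l ?y = multiple k (?x \<otimes> multiple l ?y)"
    using multiple_mult[of "multiple l ?y" ?x k] assms by auto
  show ?thesis
    using 1 2 multiple_multiple[of "?x \<otimes> ?y" l k] by (simp add: dyadic_def half_pow_add)
qed

lemma compl_half_pow: "\<sim> (half_pow n) = dyadic (2 ^ n - 1) n"
proof (rule compl_unique[symmetric])
  have "1 + (2 ^ n - 1) = (2 ^ n :: nat)"
    by simp
  then show "half_pow n \<perp> dyadic (2 ^ n - 1) n" "half_pow n \<oplus> dyadic (2 ^ n - 1) n = \<one>"
    using dyadic_plus[of 1 "2 ^ n - 1" n] multiple_pow_half_pow[of n]
    by (simp_all add: dyadic_def)
qed auto

text \<open>The inequality is strict so that a member of \<open>lower (r + s)\<close> or \<open>lower (r * s)\<close> is dominated by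
  a sum or product of members of \<open>lower r\<close> and \<open>lower s\<close>.\<close>

definition lower :: "real \<Rightarrow> 'a set"
  where "lower r = {dyadic k n | k n. k \<le> 2 ^ n \<and> (k = 0 \<or> real k < r * 2 ^ n)}"

text \<open>The image of \<open>r\<close> under the prospective embedding of the unit interval into
  \<open>M\<close>. The choice is justified by \<open>is_sup_scalar\<close>.\<close>

definition scalar :: "real \<Rightarrow> 'a"
  where "scalar r = (SOME s. is_sup (lower r) s)"

lemma lower_subset: "lower r \<subseteq> carrier M"
  by (auto simp: lower_def)

text \<open>The disjunct \<open>k = 0\<close> admits zero even for \<open>r = 0\<close>, where no
  numerator satisfies the strict inequality; directedness demands a nonempty set.\<close>

lemma zero_in_lower: "\<zero> \<in> lower r"
  unfolding lower_def by (rule CollectI, rule exI[of _ 0]) auto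

lemma lower_nonempty: "lower r \<noteq> {}"
  using zero_in_lower by blast

lemma lower_common_denominator:
  assumes "x \<in> lower r" "y \<in> lower s"
  obtains k l n where "x = dyadic k n" "y = dyadic l n" "k \<le> 2 ^ n" "l \<le> 2 ^ n"
    "k = 0 \<or> real k < r * 2 ^ n" "l = 0 \<or> real l < s * 2 ^ n"
proof -
  obtain k n where k: "x = dyadic k n" "k \<le> 2 ^ n" "k = 0 \<or> real k < r * 2 ^ n"
    using assms(1) by (auto simp: lower_def)
  obtain l m where l: "y = dyadic l m" "l \<le> 2 ^ m" "l = 0 \<or> real l < s * 2 ^ m"
    using assms(2) by (auto simp: lower_def)
  show ?thesis
  proof (rule that)
    show "x = dyadic (k * 2 ^ m) (n + m)" "y = dyadic (l * 2 ^ n) (n + m)"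
      using k l dyadic_refine[of k n m] dyadic_refine[of l m n] by (auto simp: add.commute)
    show "k * 2 ^ m \<le> 2 ^ (n + m)" "l * 2 ^ n \<le> 2 ^ (n + m)"
      using k l by (auto simp: power_add)
    show "k * 2 ^ m = 0 \<or> real (k * 2 ^ m) < r * 2 ^ (n + m)"
      "l * 2 ^ n = 0 \<or> real (l * 2 ^ n) < s * 2 ^ (n + m)"
      using k(3) l(3) by (auto simp: power_add)
  qed
qed

text \<open>Over a common denominator any two dyadic fractions are comparable, so the set is a
  chain.\<close>

lemma lower_directed:
  assumes "x \<in> lower r" "y \<in> lower r"
  shows "\<exists>z\<in>lower r. x \<preceq> z \<and> y \<preceq> z"
proof -
  obtain k l n where "x = dyadic k n" "y = dyadic l n" "k \<le> 2 ^ n" "l \<le> 2 ^ n"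
    using lower_common_denominator[OF assms] by metis
  then have "x \<preceq> y \<or> y \<preceq> x"
    using dyadic_le[of k n l n] dyadic_le[of l n k n] by (meson mult_le_mono1 nat_le_linear)
  then show ?thesis
    using assms le_refl lower_subset by blast
qed

lemma is_sup_scalar: "is_sup (lower r) (scalar r)"
  unfolding scalar_def
  by (rule someI_ex, rule ex_is_sup[OF complete lower_subset lower_nonempty lower_directed])

lemma scalar_closed [simp]: "scalar r \<in> carrier M"
  using is_sup_scalar by (rule is_sup_closed)

lemma lower_plus:
  assumes "x \<in> lower r" "y \<in> lower s" "0 \<le> r" "0 \<le> s" "r + s \<le> 1"
  shows "x \<perp> y \<and> x \<oplus> y \<in> lower (r + s)"
proof -
  obtain k l n where kl: "x = dyadic k n" "y = dyadic l n" "k \<le> 2 ^ n" "l \<le> 2 ^ n"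
    "k = 0 \<or> real k < r * 2 ^ n" "l = 0 \<or> real l < s * 2 ^ n"
    using lower_common_denominator[OF assms(1,2)] by metis
  have "real k \<le> r * 2 ^ n" "real l \<le> s * 2 ^ n"
    using kl assms by auto
  then have "real (k + l) \<le> (r + s) * 2 ^ n"
    by (simp add: algebra_simps)
  also have "\<dots> \<le> 1 * 2 ^ n"
    using assms by (intro mult_right_mono) auto
  finally have "real (k + l) \<le> real (2 ^ n)"
    by simp
  then have le: "k + l \<le> 2 ^ n"
    by (simp only: of_nat_le_iff)
  \<comment> \<open>If just one numerator is zero, its strict bound is missing; nonnegativity of the
    corresponding real takes its place.\<close>
  have "0 \<le> r * 2 ^ n" "0 \<le> s * 2 ^ n"
    using assms by auto
  then have "k + l = 0 \<or> real (k + l) < (r + s) * 2 ^ n"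
    using kl(5,6) by (auto simp: algebra_simps)
  then have "dyadic (k + l) n \<in> lower (r + s)"
    using le unfolding lower_def by blast
  then show ?thesis
    using dyadic_plus[OF le] kl by simp
qed

lemma lower_mult:
  assumes "x \<in> lower r" "y \<in> lower s"
  shows "x \<otimes> y \<in> lower (r * s)"
proof -
  obtain k l n where kl: "x = dyadic k n" "y = dyadic l n" "k \<le> 2 ^ n" "l \<le> 2 ^ n"
    "k = 0 \<or> real k < r * 2 ^ n" "l = 0 \<or> real l < s * 2 ^ n"
    using lower_common_denominator[OF assms] by metis
  have le: "k * l \<le> 2 ^ (n + n)"
    using kl by (simp add: power_add mult_le_mono)
  have "k * l = 0 \<or> real (k * l) < (r * s) * 2 ^ (n + n)"
  proof (cases "k = 0 \<or> l = 0")
    case False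
    then have "real k * real l < (r * 2 ^ n) * (s * 2 ^ n)"
      using kl by (intro mult_strict_mono) auto
    then show ?thesis
      by (simp add: power_add algebra_simps)
  qed auto
  then have "dyadic (k * l) (n + n) \<in> lower (r * s)"
    using le unfolding lower_def by blast
  then show ?thesis
    using dyadic_mult kl by simp
qed

lemma lower_approx:
  assumes "0 \<le> r" "r \<le> 1"
  obtains i where "dyadic i n \<in> lower r" "i \<le> 2 ^ n" "r * 2 ^ n - 1 \<le> real i"
proof -
  \<comment> \<open>The largest integer strictly below \<open>r * 2 ^ n\<close>; for
    \<open>r = 0\<close> this would be -1, which \<open>nat\<close> cuts off to 0.\<close>
  define i where "i = nat (\<lceil>r * 2 ^ n\<rceil> - 1)"
  have lt: "i = 0 \<or> real i < r * 2 ^ n" and ge: "r * 2 ^ n - 1 \<le> real i"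
    unfolding i_def by linarith+
  have "r * 2 ^ n \<le> real (2 ^ n)"
    using assms mult_right_mono[of r 1 "2 ^ n"] by simp
  with lt have "i = 0 \<or> real i < real (2 ^ n)"
    using less_le_trans by blast
  then have "i \<le> 2 ^ n"
    unfolding of_nat_less_iff by auto
  then show ?thesis
    using that[of i] lt ge unfolding lower_def by blast
qed

text \<open>The strict inequality leaves a gap that a large power of 2 magnifies beyond
  \<open>2 * 2 ^ n\<close>. The constant 2 pays for rounding two reals down at scale
  \<open>2 ^ N\<close>.\<close>

lemma lower_gap:
  assumes "real k < r * 2 ^ n"
  obtains N where "real k * 2 ^ N \<le> (r * 2 ^ N - 2) * 2 ^ n"
proof -
  define d where "d = r * 2 ^ n - real k"
  have "0 < d"
    using assms by (simp add: d_def)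
  obtain N where "2 * 2 ^ n / d < (2 :: real) ^ N"
    using real_arch_pow[of 2] by auto
  then have "2 * 2 ^ n < d * 2 ^ N"
    using \<open>0 < d\<close> by (simp add: divide_less_eq mult.commute)
  then have "real k * 2 ^ N \<le> (r * 2 ^ N - 2) * 2 ^ n"
    by (simp add: d_def algebra_simps)
  then show ?thesis
    by (rule that)
qed

lemma lower_le_plus:
  assumes x: "x \<in> lower (r + s)" and rs: "0 \<le> r" "0 \<le> s" "r + s \<le> 1"
  shows "\<exists>y\<in>lower r. \<exists>z\<in>lower s. x \<preceq> y \<oplus> z"
proof -
  obtain k n where k: "x = dyadic k n" "k \<le> 2 ^ n" "k = 0 \<or> real k < (r + s) * 2 ^ n"
    using x by (auto simp: lower_def)
  show ?thesis
  proof (cases "k = 0")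
    case True
    then show ?thesis
      using k zero_in_lower by (intro bexI[of _ \<zero>]) auto
  next
    case False
    then obtain N where N: "real k * 2 ^ N \<le> ((r + s) * 2 ^ N - 2) * 2 ^ n"
      using lower_gap k(3) by metis
    obtain i where i: "dyadic i N \<in> lower r" "i \<le> 2 ^ N" "r * 2 ^ N - 1 \<le> real i"
      using lower_approx[of r N] rs by auto
    obtain j where j: "dyadic j N \<in> lower s" "j \<le> 2 ^ N" "s * 2 ^ N - 1 \<le> real j"
      using lower_approx[of s N] rs by auto
    have "(r + s) * 2 ^ N - 2 \<le> real (i + j)"
      using i(3) j(3) by (simp add: algebra_simps)
    then have "((r + s) * 2 ^ N - 2) * 2 ^ n \<le> real (i + j) * 2 ^ n"
      by (intro mult_right_mono) auto
    then have "real k * 2 ^ N \<le> real (i + j) * 2 ^ n"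
      using N order_trans by blast
    then have "real (k * 2 ^ N) \<le> real ((i + j) * 2 ^ n)"
      by simp
    then have kij: "k * 2 ^ N \<le> (i + j) * 2 ^ n"
      by (simp only: of_nat_le_iff)
    show ?thesis
    proof (cases "i + j \<le> 2 ^ N")
      case True
      then have "x \<preceq> dyadic i N \<oplus> dyadic j N"
        using dyadic_plus[OF True] dyadic_le[OF k(2) True kij] k(1) by simp
      then show ?thesis
        using i j by blast
    next
      case False
      \<comment> \<open>The facts obtained on \<open>i\<close> and \<open>j\<close> do not bound
        their sum. Here \<open>dyadic j N\<close> lies above the complement of
        \<open>dyadic i N\<close>, so the sum of the two reaches \<open>\<one>\<close>.\<close>
      then have "2 ^ N - i \<le> j" "i + (2 ^ N - i) = 2 ^ N"
        using i(2) by auto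
      then have "dyadic i N \<perp> dyadic (2 ^ N - i) N" "dyadic i N \<oplus> dyadic (2 ^ N - i) N = \<one>"
        using dyadic_plus[of i "2 ^ N - i" N] multiple_pow_half_pow[of N] by (auto simp: dyadic_def)
      moreover have "dyadic i N \<perp> dyadic j N"
        using lower_plus[OF i(1) j(1) rs] by blast
      moreover have "dyadic (2 ^ N - i) N \<preceq> dyadic j N"
        using dyadic_le[of "2 ^ N - i" N j N] j(2) \<open>2 ^ N - i \<le> j\<close> by simp
      ultimately have "\<one> \<preceq> dyadic i N \<oplus> dyadic j N"
        using plus_mono(2)[of "dyadic i N" "dyadic i N" "dyadic (2 ^ N - i) N" "dyadic j N"] i j by simp
      then have "x \<preceq> dyadic i N \<oplus> dyadic j N"
        using le_trans[of x \<one>] k by simp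
      then show ?thesis
        using i j by blast
    qed
  qed
qed

lemma lower_le_mult:
  assumes x: "x \<in> lower (r * s)" and rs: "r \<in> {0..1}" "s \<in> {0..1}"
  shows "\<exists>y\<in>lower r. \<exists>z\<in>lower s. x \<preceq> y \<otimes> z"
proof -
  obtain k n where k: "x = dyadic k n" "k \<le> 2 ^ n" "k = 0 \<or> real k < (r * s) * 2 ^ n"
    using x by (auto simp: lower_def)
  show ?thesis
  proof (cases "k = 0")
    case True
    then show ?thesis
      using k zero_in_lower by (intro bexI[of _ \<zero>]) auto
  next
    case False
    then obtain N where N: "real k * 2 ^ N \<le> ((r * s) * 2 ^ N - 2) * 2 ^ n"
      using lower_gap k(3) by metis
    obtain i where i: "dyadic i N \<in> lower r" "i \<le> 2 ^ N" "r * 2 ^ N - 1 \<le> real i"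
      using lower_approx[of r N] rs by auto
    obtain j where j: "dyadic j N \<in> lower s" "j \<le> 2 ^ N" "s * 2 ^ N - 1 \<le> real j"
      using lower_approx[of s N] rs by auto
    \<comment> \<open>With \<open>k\<close> positive, the choice of \<open>N\<close> forces this. It
      makes \<open>r * 2 ^ N - 1\<close> and \<open>s * 2 ^ N - 1\<close> nonnegative, so that their
      product can be bounded by \<open>i * j\<close>.\<close>
    have "0 \<le> (r * s) * 2 ^ N - 2"
    proof -
      have "0 < real k * 2 ^ N"
        using False by simp
      also note N
      finally show ?thesis
        by (simp add: zero_less_mult_iff)
    qed
    moreover have "r * s \<le> r" "r * s \<le> s"
      using rs mult_left_le[of s r] mult_left_le[of r s] by (auto simp: mult.commute)
    then have "(r * s) * 2 ^ N \<le> r * 2 ^ N" "(r * s) * 2 ^ N \<le> s * 2 ^ N"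
      by (auto intro!: mult_right_mono)
    ultimately have "(r * 2 ^ N - 1) * (s * 2 ^ N - 1) \<le> real i * real j"
      using i j by (intro mult_mono) auto
    moreover have "r * 2 ^ N \<le> 2 ^ N" "s * 2 ^ N \<le> 2 ^ N"
      using rs mult_right_mono[of _ 1 "2 ^ N"] by auto
    ultimately have ij: "((r * s) * 2 ^ N - 2) * 2 ^ N \<le> real (i * j)"
      using approx_mult[of "r * 2 ^ N" "s * 2 ^ N" "real i * real j"] by simp
    have "real (k * 2 ^ (N + N)) = real k * 2 ^ N * 2 ^ N"
      by (simp add: power_add)
    also have "\<dots> \<le> ((r * s) * 2 ^ N - 2) * 2 ^ n * 2 ^ N"
      using N by (rule mult_right_mono) simp
    also have "\<dots> = ((r * s) * 2 ^ N - 2) * 2 ^ N * 2 ^ n"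
      by (simp only: mult_ac)
    also have "\<dots> \<le> real (i * j) * 2 ^ n"
      using ij by (rule mult_right_mono) simp
    also have "\<dots> = real (i * j * 2 ^ n)"
      by simp
    finally have "real (k * 2 ^ (N + N)) \<le> real (i * j * 2 ^ n)" .
    then have kij: "k * 2 ^ (N + N) \<le> i * j * 2 ^ n"
      by (simp only: of_nat_le_iff)
    have "i * j \<le> 2 ^ (N + N)"
      using i j by (simp add: power_add mult_le_mono)
    then have "x \<preceq> dyadic i N \<otimes> dyadic j N"
      using dyadic_mult[of i N j N] dyadic_le[OF k(2) _ kij] k(1) i j by simp
    then show ?thesis
      using i j by blast
  qed
qed

section \<open>Arithmetic of real scalars and the convex action\<close>

lemma scalar_plus:
  assumes rs: "0 \<le> r" "0 \<le> s" "r + s \<le> 1"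
  shows "scalar r \<perp> scalar s \<and> scalar r \<oplus> scalar s = scalar (r + s)"
proof -
  have le: "scalar r \<perp> scalar s \<and> scalar r \<oplus> scalar s \<preceq> scalar (r + s)"
  proof (rule is_sup_plus_le[OF lower_subset lower_nonempty is_sup_scalar
        lower_subset lower_nonempty is_sup_scalar scalar_closed])
    fix x y assume "x \<in> lower r" "y \<in> lower s"
    then show "x \<perp> y \<and> x \<oplus> y \<preceq> scalar (r + s)"
      using lower_plus rs is_sup_upper[OF is_sup_scalar] by blast
  qed
  have "scalar (r + s) \<preceq> scalar r \<oplus> scalar s"
  proof (rule is_sup_least[OF is_sup_scalar])
    fix x assume x: "x \<in> lower (r + s)"
    then obtain y z where yz: "y \<in> lower r" "z \<in> lower s" "x \<preceq> y \<oplus> z"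
      using lower_le_plus rs by blast
    have "y \<oplus> z \<preceq> scalar r \<oplus> scalar s"
      using plus_mono(2)[of y "scalar r" z "scalar s"] yz le
        is_sup_upper[OF is_sup_scalar] lower_subset by (auto dest: subsetD)
    then show "x \<preceq> scalar r \<oplus> scalar s"
      using yz x le_trans lower_subset by blast
  qed (use le in auto)
  then show ?thesis
    using le le_antisym by auto
qed

text \<open>Left and right multiplications are additive deflations, so
  \<open>additive_deflation_sup_le\<close> passes to the supremum in one factor at a time. The
  converse bound comes from the approximation in \<open>lower_le_mult\<close>.\<close>

lemma scalar_mult:
  assumes rs: "r \<in> {0..1}" "s \<in> {0..1}"
  shows "scalar r \<otimes> scalar s = scalar (r * s)"
proof (rule le_antisym)
  have "x \<otimes> scalar s \<preceq> scalar (r * s)" if x: "x \<in> lower r" for x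
  proof -
    have xM: "x \<in> carrier M"
      using x lower_subset by blast
    show ?thesis
    proof (rule additive_deflation_sup_le[OF complete lower_subset lower_nonempty lower_directed
        is_sup_scalar, where \<phi> = "\<lambda>y. x \<otimes> y"])
      fix y assume "y \<in> lower s"
      then show "x \<otimes> y \<preceq> scalar (r * s)"
        using lower_mult x is_sup_upper[OF is_sup_scalar] by blast
    qed (use xM distrib_left mult_le_right in auto)
  qed
  then show "scalar r \<otimes> scalar s \<preceq> scalar (r * s)"
    by (intro additive_deflation_sup_le[OF complete lower_subset lower_nonempty lower_directed
        is_sup_scalar, where \<phi> = "\<lambda>x. x \<otimes> scalar s"])
      (use distrib_right mult_le_left in auto)
  show "scalar (r * s) \<preceq> scalar r \<otimes> scalar s"
  proof (rule is_sup_least[OF is_sup_scalar])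
    fix x assume x: "x \<in> lower (r * s)"
    then obtain y z where yz: "y \<in> lower r" "z \<in> lower s" "x \<preceq> y \<otimes> z"
      using lower_le_mult rs by blast
    have "y \<otimes> z \<preceq> scalar r \<otimes> scalar s"
      using emult_mono[of y "scalar r" z "scalar s"] yz is_sup_upper[OF is_sup_scalar] lower_subset
      by (auto dest: subsetD)
    then show "x \<preceq> scalar r \<otimes> scalar s"
      using yz x le_trans lower_subset by blast
  qed auto
qed auto

text \<open>The complement \<open>e\<close> of \<open>scalar 1\<close> is the greatest element below every power of \<open>half\<close>, and
  \<open>e \<oplus> e\<close> is another such element.\<close>

lemma scalar_one: "scalar 1 = \<one>"
proof -
  define e where "e = \<sim> (scalar 1)"
  have e: "e \<in> carrier M"
    by (simp add: e_def)
  have below: "e \<preceq> half_pow n" for n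
  proof -
    have "2 ^ n - 1 \<le> (2 :: nat) ^ n" "real (2 ^ n - 1) < 1 * 2 ^ n"
      by (simp_all add: of_nat_diff)
    then have "\<sim> (half_pow n) \<in> lower 1"
      unfolding compl_half_pow lower_def by blast
    then have "\<sim> (half_pow n) \<preceq> scalar 1"
      by (rule is_sup_upper[OF is_sup_scalar])
    then show ?thesis
      using compl_anti[of "\<sim> (half_pow n)" "scalar 1"] by (simp add: e_def)
  qed
  have greatest: "y \<preceq> e" if y: "y \<in> carrier M" "\<And>n. y \<preceq> half_pow n" for y
  proof -
    have "scalar 1 \<preceq> \<sim> y"
    proof (rule is_sup_least[OF is_sup_scalar])
      fix x assume "x \<in> lower 1"
      then obtain k n where k: "x = dyadic k n" "k \<le> 2 ^ n" "k = 0 \<or> real k < 1 * 2 ^ n"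
        by (auto simp: lower_def)
      then have "k = 0 \<or> real k < real (2 ^ n)"
        by simp
      \<comment> \<open>The strict bound leaves room for one more \<open>half_pow n\<close>, so
        \<open>x\<close> lies below the complement of \<open>half_pow n\<close>, and that complement
        lies below \<open>\<sim> y\<close>.\<close>
      then have "k \<le> 2 ^ n - 1"
        unfolding of_nat_less_iff by auto
      then have "x \<preceq> \<sim> (half_pow n)"
        using k by (simp add: compl_half_pow dyadic_le)
      also have "\<sim> (half_pow n) \<preceq> \<sim> y"
        using compl_anti y by simp
      finally show "x \<preceq> \<sim> y"
        using k by simp
    qed (use y in auto)
    then show ?thesis
      using compl_anti[of "scalar 1" "\<sim> y"] y by (simp add: e_def)
  qed
  have "e \<perp> e"
    using plus_mono(1)[of e half e half] below[of 1] half_orth e by simp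
  moreover have "e \<oplus> e \<preceq> half_pow n" for n
    using plus_mono(2)[of e "half_pow (Suc n)" e "half_pow (Suc n)"] below[of "Suc n"]
      half_pow_Suc_plus[of n] half_pow_closed[of "Suc n"] e by (simp del: half_pow.simps)
  ultimately have "e \<oplus> e = e"
    using greatest[of "e \<oplus> e"] le_plus[of e e] le_antisym[of "e \<oplus> e" e] e by simp
  then have "e = \<zero>"
    using plus_eq_left_iff[of e e] e \<open>e \<perp> e\<close> by simp
  then show ?thesis
    using compl_compl[of "scalar 1"] by (simp add: e_def compl_zero)
qed

lemma convex_effect_algebra: "convex_effect_algebra M"
proof -
  have "convex_action M (\<lambda>r a. scalar r \<otimes> a)"
  proof (unfold_locales, goal_cases)
    case (2 r s a)
    then show ?case
      by (simp flip: mult_assoc scalar_mult)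
  next
    case (3 r s a)
    then show ?case
      using scalar_plus[of r s] distrib_right[of a "scalar r" "scalar s"] by auto
  next
    case (4 r a b)
    then show ?case
      using distrib_left[of "scalar r" a b] by auto
  qed (auto simp: scalar_one)
  then show ?thesis
    unfolding convex_effect_algebra_def by blast
qed

end

section \<open>Effect monoids of idempotents\<close>

locale idempotent_effect_monoid = effect_monoid +
  assumes idem [simp]: "a \<in> carrier M \<Longrightarrow> a \<otimes> a = a"
    and complete: "directed_complete M"
begin

text \<open>Here \<open>z = z \<otimes> z\<close>, so monotonicity applies to both factors; the
  product is thus the meet.\<close>

lemma le_mult: "\<lbrakk>z \<preceq> a; z \<preceq> b; z \<in> carrier M; a \<in> carrier M; b \<in> carrier M\<rbrakk> \<Longrightarrow> z \<preceq> a \<otimes> b"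
  using emult_mono[of z a z b] by simp

text \<open>The element \<open>a \<oplus> \<sim> a \<otimes> b\<close> is going to be the join:
  \<open>b\<close> splits into \<open>a \<otimes> b\<close>, which \<open>a\<close> absorbs, and
  \<open>\<sim> a \<otimes> b\<close>, which is disjoint from \<open>a\<close>.\<close>

lemma join_orth: "\<lbrakk>a \<in> carrier M; b \<in> carrier M\<rbrakk> \<Longrightarrow> a \<perp> \<sim> a \<otimes> b"
  using mult_le_left[of "\<sim> a" b] orth_iff_le_compl[of "\<sim> a \<otimes> b" a] orth_sym[of "\<sim> a \<otimes> b" a] by simp

lemma join_closed: "\<lbrakk>a \<in> carrier M; b \<in> carrier M\<rbrakk> \<Longrightarrow> a \<oplus> \<sim> a \<otimes> b \<in> carrier M"
  using join_orth by simp

lemma join_upper: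
  assumes "a \<in> carrier M" "b \<in> carrier M"
  shows "a \<preceq> a \<oplus> \<sim> a \<otimes> b" "b \<preceq> a \<oplus> \<sim> a \<otimes> b"
proof -
  show "a \<preceq> a \<oplus> \<sim> a \<otimes> b"
    using assms join_orth le_plus by simp
  have "a \<otimes> b \<oplus> \<sim> a \<otimes> b \<preceq> a \<oplus> \<sim> a \<otimes> b"
    using orth_mono(2)[of "a \<otimes> b" a "\<sim> a \<otimes> b"] assms join_orth mult_le_left by simp
  then show "b \<preceq> a \<oplus> \<sim> a \<otimes> b"
    using assms mult_add_compl_left by simp
qed

lemma join_least:
  assumes "a \<preceq> u" "b \<preceq> u" "a \<in> carrier M" "b \<in> carrier M" "u \<in> carrier M"
  shows "a \<oplus> \<sim> a \<otimes> b \<preceq> u"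
  using plus_le_idem[of u a "\<sim> a \<otimes> b"] le_trans[of "\<sim> a \<otimes> b" b u] mult_le_right[of "\<sim> a" b]
    join_orth assms by simp

section \<open>The complete lattice of idempotents\<close>

lemma partial_order_effect_order: "partial_order (effect_order M)"
  by unfold_locales (use le_antisym le_trans in auto)

lemma ex_sup:
  assumes "A \<subseteq> carrier M"
  shows "\<exists>s. is_sup A s"
proof -
  \<comment> \<open>All elements below every upper bound of \<open>A\<close>. The set contains
    \<open>A\<close>, has the same upper bounds and is closed under joins, so it is directed
    although \<open>A\<close> need not be.\<close>
  define D where "D = {x \<in> carrier M. \<forall>u\<in>carrier M. (\<forall>a\<in>A. a \<preceq> u) \<longrightarrow> x \<preceq> u}"
  have "\<exists>s. is_sup D s"
  proof (rule ex_is_sup[OF complete])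
    have "\<zero> \<in> D"
      by (simp add: D_def)
    then show "D \<noteq> {}"
      by blast
  next
    fix x y assume xy: "x \<in> D" "y \<in> D"
    then have "x \<oplus> \<sim> x \<otimes> y \<in> D"
      using join_least join_closed by (simp add: D_def)
    then show "\<exists>z\<in>D. x \<preceq> z \<and> y \<preceq> z"
      using join_upper[of x y] xy by (auto simp: D_def)
  qed (auto simp: D_def)
  then obtain s where s: "is_sup D s"
    by blast
  have "A \<subseteq> D"
    using assms by (auto simp: D_def)
  then have "is_sup A s"
    using s unfolding is_sup_def D_def by blast
  then show ?thesis
    by blast
qed

lemma complete_lattice_effect_order: "complete_lattice (effect_order M)"
proof -
  interpret partial_order "effect_order M"
    by (rule partial_order_effect_order)
  show ?thesis
  proof (rule complete_latticeI)
    fix A assume "A \<subseteq> carrier (effect_order M)"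
    then show "\<exists>s. least (effect_order M) s (Upper (effect_order M) A)"
      using ex_sup[of A] is_sup_iff_least[of A] by auto
  next
    fix A assume A: "A \<subseteq> carrier (effect_order M)"
    \<comment> \<open>The infimum is the supremum of all lower bounds.\<close>
    obtain s where s: "is_sup (Lower (effect_order M) A) s"
      using ex_sup[of "Lower (effect_order M) A"] Lower_closed[of "effect_order M" A] by auto
    have "greatest (effect_order M) s (Lower (effect_order M) A)"
    proof (rule greatest_LowerI)
      fix x assume "x \<in> A"
      then show "s \<preceq> x"
        using is_sup_least[OF s] A by (auto simp: Lower_def)
    qed (use s A is_sup_upper is_sup_closed in auto)
    then show "\<exists>s. greatest (effect_order M) s (Lower (effect_order M) A)"
      by blast
  qed
qed

lemma bottom_effect_order: "\<bottom>\<^bsub>effect_order M\<^esub> = \<zero>"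
  and top_effect_order: "\<top>\<^bsub>effect_order M\<^esub> = \<one>"
proof -
  interpret L: complete_lattice "effect_order M"
    by (rule complete_lattice_effect_order)
  have "\<bottom>\<^bsub>effect_order M\<^esub> \<in> carrier M" "\<top>\<^bsub>effect_order M\<^esub> \<in> carrier M"
    using L.bottom_closed L.top_closed by simp_all
  then show "\<bottom>\<^bsub>effect_order M\<^esub> = \<zero>" "\<top>\<^bsub>effect_order M\<^esub> = \<one>"
    using L.bottom_lower[of \<zero>] L.top_higher[of \<one>] le_zeroD le_antisym[of "\<top>\<^bsub>effect_order M\<^esub>" \<one>]
    by simp_all
qed

lemma meet_effect_order:
  assumes "a \<in> carrier M" "b \<in> carrier M"
  shows "a \<sqinter>\<^bsub>effect_order M\<^esub> b = a \<otimes> b"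
proof -
  interpret L: complete_lattice "effect_order M"
    by (rule complete_lattice_effect_order)
  show ?thesis
    using L.meet_left[of a b] L.meet_right[of a b] L.meet_le[of "a \<otimes> b" a b] L.meet_closed[of a b]
      le_mult[of "a \<sqinter>\<^bsub>effect_order M\<^esub> b" a b] le_antisym mult_le_left mult_le_right assms
    by simp
qed

lemma join_effect_order:
  assumes "a \<in> carrier M" "b \<in> carrier M"
  shows "a \<squnion>\<^bsub>effect_order M\<^esub> b = a \<oplus> \<sim> a \<otimes> b"
proof -
  interpret L: complete_lattice "effect_order M"
    by (rule complete_lattice_effect_order)
  show ?thesis
    using L.join_left[of a b] L.join_right[of a b] L.join_le[of a "a \<oplus> \<sim> a \<otimes> b" b]
      L.join_closed[of a b] join_least[of a "a \<squnion>\<^bsub>effect_order M\<^esub> b" b] join_upper[of a b]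
      join_closed[of a b] le_antisym assms
    by simp
qed

text \<open>If \<open>a \<perp> b\<close>, then \<open>b\<close> lies below \<open>\<sim> a\<close>,
  and \<open>a \<otimes> \<sim> a\<close> vanishes. Conversely a zero product leaves
  \<open>b = \<sim> a \<otimes> b\<close>, which is orthogonal to \<open>a\<close>.\<close>

lemma orth_iff_mult_eq_zero:
  assumes "a \<in> carrier M" "b \<in> carrier M"
  shows "a \<perp> b \<longleftrightarrow> a \<otimes> b = \<zero>"
proof
  assume "a \<perp> b"
  then have "b \<preceq> \<sim> a"
    using orth_iff_le_compl[of b a] orth_sym assms by simp
  then have "a \<otimes> b \<preceq> a \<otimes> \<sim> a"
    using emult_mono[of a a b "\<sim> a"] assms by simp
  then show "a \<otimes> b = \<zero>"
    using idem_iff[of a] le_zeroD assms by simp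
next
  assume "a \<otimes> b = \<zero>"
  then have "b = \<sim> a \<otimes> b"
    using mult_add_compl_left(2)[of a b] assms by simp
  then show "a \<perp> b"
    using join_orth[of a b] assms by simp
qed

lemma plus_eq_join:
  assumes "a \<in> carrier M" "b \<in> carrier M" "a \<perp> b"
  shows "a \<squnion>\<^bsub>effect_order M\<^esub> b = a \<oplus> b"
  using mult_add_compl_left(2)[of a b] orth_iff_mult_eq_zero[of a b] assms
  by (simp add: join_effect_order)

lemma complete_boolean_algebra_effect_order: "complete_boolean_algebra (effect_order M)"
proof -
  interpret L: complete_lattice "effect_order M"
    by (rule complete_lattice_effect_order)
  show ?thesis
  proof (unfold_locales, goal_cases)
    case (1 x y z)
    then have c: "x \<in> carrier M" "y \<in> carrier M" "z \<in> carrier M"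
      by auto
    \<comment> \<open>The two sides of the distributive law, with meet and join written out. As
      \<open>?j\<close> is idempotent, it dominates a sum as soon as it dominates the
      summands.\<close>
    let ?m = "x \<otimes> (y \<oplus> \<sim> y \<otimes> z)" and ?j = "x \<otimes> y \<oplus> \<sim> (x \<otimes> y) \<otimes> (x \<otimes> z)"
    have mj: "?m \<in> carrier M" "?j \<in> carrier M"
      using c join_closed by simp_all
    have j: "x \<otimes> y \<preceq> ?j" "x \<otimes> z \<preceq> ?j"
      using join_upper c by simp_all
    have "x \<otimes> (\<sim> y \<otimes> z) \<preceq> x \<otimes> z"
      using emult_mono[of x x "\<sim> y \<otimes> z" z] mult_le_right c by simp
    then have "x \<otimes> (\<sim> y \<otimes> z) \<preceq> ?j"
      using j le_trans c by (meson compl_closed mult_closed)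
    moreover have "x \<otimes> y \<perp> x \<otimes> (\<sim> y \<otimes> z)" "?m = x \<otimes> y \<oplus> x \<otimes> (\<sim> y \<otimes> z)"
      using distrib_left[of x y "\<sim> y \<otimes> z"] join_orth c by simp_all
    ultimately have "?m \<preceq> ?j"
      using plus_le_idem[of ?j "x \<otimes> y" "x \<otimes> (\<sim> y \<otimes> z)"] j mj c by simp
    moreover have "x \<otimes> y \<preceq> ?m" "x \<otimes> z \<preceq> ?m"
      using emult_mono[of x x] join_upper[of y z] join_closed[of y z] c by simp_all
    then have "?j \<preceq> ?m"
      using join_least mj c by simp
    ultimately have "?m = ?j"
      using le_antisym mj by blast
    then show ?case
      using c join_closed by (simp add: meet_effect_order join_effect_order)
  next
    case (2 x)
    then have "x \<otimes> \<sim> x = \<zero>"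
      using idem_iff[of x] by simp
    then show ?case
      using 2 plus_eq_join[of x "\<sim> x"]
      by (intro bexI[of _ "\<sim> x"])
        (simp_all add: meet_effect_order bottom_effect_order top_effect_order)
  qed
qed

text \<open>A lattice complement of \<open>a\<close> is orthogonal to it and their sum is
  \<open>\<one>\<close>, so uniqueness of complements in \<open>M\<close> settles the definite
  description.\<close>

lemma compl_boolean_effect_monoid:
  assumes "a \<in> carrier M"
  shows "\<sim>\<^bsub>boolean_effect_monoid (effect_order M)\<^esub> a = \<sim> a"
proof -
  have "(THE y. y \<in> carrier M \<and> a \<sqinter>\<^bsub>effect_order M\<^esub> y = \<zero> \<and> a \<squnion>\<^bsub>effect_order M\<^esub> y = \<one>) = \<sim> a"
  proof (rule the_equality)
    show "\<sim> a \<in> carrier M \<and> a \<sqinter>\<^bsub>effect_order M\<^esub> \<sim> a = \<zero> \<and> a \<squnion>\<^bsub>effect_order M\<^esub> \<sim> a = \<one>"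
      using assms plus_eq_join[of a "\<sim> a"] idem_iff[of a] by (simp add: meet_effect_order)
  next
    fix y assume y: "y \<in> carrier M \<and> a \<sqinter>\<^bsub>effect_order M\<^esub> y = \<zero> \<and> a \<squnion>\<^bsub>effect_order M\<^esub> y = \<one>"
    then have "a \<perp> y"
      using assms orth_iff_mult_eq_zero[of a y] meet_effect_order[of a y] by simp
    moreover from this have "a \<oplus> y = \<one>"
      using plus_eq_join[of a y] y assms by metis
    ultimately show "y = \<sim> a"
      using compl_unique y assms by blast
  qed
  then show ?thesis
    by (simp add: boolean_effect_monoid_def bottom_effect_order top_effect_order)
qed

end

section \<open>The decomposition\<close>

context effect_monoid begin

text \<open>Since \<open>p \<otimes> b = p \<otimes> \<sim> p \<otimes> b = \<zero>\<close>, and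
  likewise with the roles exchanged, the components can be read off the sum; so addition inverts the
  splitting map.\<close>

lemma idem_plus_orth:
  assumes p: "p \<in> carrier M" "p \<otimes> p = p"
    and ab: "a \<in> carrier M" "b \<in> carrier M" "a \<preceq> p" "b \<preceq> \<sim> p"
  shows "a \<perp> b" "p \<otimes> (a \<oplus> b) = a" "\<sim> p \<otimes> (a \<oplus> b) = b"
proof -
  show o: "a \<perp> b"
    using plus_mono(1)[of a p b "\<sim> p"] p ab by simp
  have 1: "p \<otimes> a = a" "\<sim> p \<otimes> b = b"
    using p ab le_idem_iff idem_compl by simp_all
  have "p \<otimes> b = (p \<otimes> \<sim> p) \<otimes> b" "\<sim> p \<otimes> a = (\<sim> p \<otimes> p) \<otimes> a"
    using 1 p ab mult_assoc by simp_all
  then have 2: "p \<otimes> b = \<zero>" "\<sim> p \<otimes> a = \<zero>"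
    using p ab idem_iff mult_compl_commute[of p] by simp_all
  show "p \<otimes> (a \<oplus> b) = a" "\<sim> p \<otimes> (a \<oplus> b) = b"
    using distrib_left[of p a b] distrib_left[of "\<sim> p" a b] 1 2 o p ab by simp_all
qed

lemma orth_idem_split:
  assumes p: "p \<in> carrier M" "p \<otimes> p = p" and ab: "a \<in> carrier M" "b \<in> carrier M"
  shows "a \<perp> b \<longleftrightarrow> p \<otimes> a \<perp> p \<otimes> b \<and> \<sim> p \<otimes> a \<perp> \<sim> p \<otimes> b"
proof
  assume "a \<perp> b"
  then show "p \<otimes> a \<perp> p \<otimes> b \<and> \<sim> p \<otimes> a \<perp> \<sim> p \<otimes> b"
    using distrib_left p ab by simp
next
  assume o: "p \<otimes> a \<perp> p \<otimes> b \<and> \<sim> p \<otimes> a \<perp> \<sim> p \<otimes> b"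
  have "p \<otimes> a \<oplus> p \<otimes> b \<preceq> p" "\<sim> p \<otimes> a \<oplus> \<sim> p \<otimes> b \<preceq> \<sim> p"
    using plus_le_idem[of p "p \<otimes> a" "p \<otimes> b"] plus_le_idem[of "\<sim> p" "\<sim> p \<otimes> a" "\<sim> p \<otimes> b"]
      idem_compl mult_le_left o p ab by simp_all
  \<comment> \<open>The two partial sums lie below \<open>p\<close> and \<open>\<sim> p\<close>, so
    they are orthogonal; regrouping by component turns them into \<open>a\<close> and
    \<open>b\<close>.\<close>
  then have "p \<otimes> a \<oplus> p \<otimes> b \<perp> \<sim> p \<otimes> a \<oplus> \<sim> p \<otimes> b"
    using idem_plus_orth(1) o p ab by simp
  then have "p \<otimes> a \<oplus> \<sim> p \<otimes> a \<perp> p \<otimes> b \<oplus> \<sim> p \<otimes> b"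
    using plus_plus_commute(3)[of "p \<otimes> a" "p \<otimes> b" "\<sim> p \<otimes> a" "\<sim> p \<otimes> b"] o p ab by simp
  then show "a \<perp> b"
    using mult_add_compl_left p ab by simp
qed

lemma isomorphic_corner_sum:
  assumes p: "p \<in> carrier M" "p \<otimes> p = p"
    and B: "idempotent_effect_monoid (corner M (\<sim> p))"
  shows "M \<cong> corner M p \<oplus>\<oplus> boolean_effect_monoid (effect_order (corner M (\<sim> p)))"
proof -
  interpret B: idempotent_effect_monoid "corner M (\<sim> p)"
    by (rule B)
  let ?f = "\<lambda>a. (p \<otimes> a, \<sim> p \<otimes> a)"
  have q: "\<sim> p \<in> carrier M" "\<sim> p \<otimes> \<sim> p = \<sim> p"
    using p idem_compl by simp_all
  have in_q: "\<sim> p \<otimes> a \<in> carrier (corner M (\<sim> p))" if "a \<in> carrier M" for a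
    using that q mult_le_left by simp
  have compl: "r \<otimes> \<sim> (r \<otimes> a) = r \<otimes> \<sim> a"
    if r: "r \<in> carrier M" "r \<otimes> r = r" and a: "a \<in> carrier M" for r a
  proof -
    \<comment> \<open>Both \<open>\<sim> (r \<otimes> a)\<close> and \<open>\<sim> a\<close>,
      multiplied by \<open>r\<close>, complete \<open>r \<otimes> a\<close> to \<open>r\<close>;
      cancellation identifies them.\<close>
    have "r \<otimes> a \<perp> r \<otimes> \<sim> (r \<otimes> a)" "r \<otimes> a \<oplus> r \<otimes> \<sim> (r \<otimes> a) = r"
      using distrib_left[of r "r \<otimes> a" "\<sim> (r \<otimes> a)"] r a by (simp_all flip: mult_assoc)
    moreover have "r \<otimes> a \<perp> r \<otimes> \<sim> a" "r \<otimes> a \<oplus> r \<otimes> \<sim> a = r"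
      using distrib_left[of r a "\<sim> a"] r a by simp_all
    ultimately show ?thesis
      using plus_left_cancel[of "r \<otimes> a"] r a by simp
  qed
  have mult: "r \<otimes> (a \<otimes> b) = (r \<otimes> a) \<otimes> (r \<otimes> b)"
    if r: "r \<in> carrier M" "r \<otimes> r = r" and ab: "a \<in> carrier M" "b \<in> carrier M" for r a b
  proof -
    \<comment> \<open>Centrality of \<open>r\<close> makes the inner factor of
      \<open>(r \<otimes> a) \<otimes> (r \<otimes> b)\<close> disappear.\<close>
    have "(r \<otimes> a) \<otimes> r = r \<otimes> a"
      using idem_commute[of r "r \<otimes> a"] r ab by (simp flip: mult_assoc)
    then show ?thesis
      using mult_assoc[of "r \<otimes> a" r b] mult_assoc[of r a b] r ab by simp
  qed
  have bij: "bij_betw ?f (carrier M) (carrier (corner M p) \<times> carrier (corner M (\<sim> p)))"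
  proof (rule bij_betwI[where g = "\<lambda>(a, b). a \<oplus> b"])
    show "?f \<in> carrier M \<rightarrow> carrier (corner M p) \<times> carrier (corner M (\<sim> p))"
      using p q mult_le_left by auto
    show "(\<lambda>(a, b). a \<oplus> b) \<in> carrier (corner M p) \<times> carrier (corner M (\<sim> p)) \<rightarrow> carrier M"
      using idem_plus_orth(1) p by auto
  qed (use p mult_add_compl_left idem_plus_orth in auto)
  have "?f \<in> effect_monoid_iso M
      (corner M p \<oplus>\<oplus> boolean_effect_monoid (effect_order (corner M (\<sim> p))))"
    unfolding effect_monoid_iso_def direct_sum_def
  proof (simp, intro conjI ballI impI)
    show "bij_betw ?f (carrier M)
        ({a \<in> carrier M. a \<preceq> p} \<times> carrier (boolean_effect_monoid (effect_order (corner M (\<sim> p)))))"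
      using bij by (simp add: boolean_effect_monoid_def)
    show "p \<otimes> \<zero> = \<zero>" "\<sim> p \<otimes> \<zero> = \<zero>\<^bsub>boolean_effect_monoid (effect_order (corner M (\<sim> p)))\<^esub>"
      using p q B.bottom_effect_order by (simp_all add: boolean_effect_monoid_def)
  next
    fix a assume a: "a \<in> carrier M"
    show "p \<otimes> \<sim> a = p \<otimes> \<sim> (p \<otimes> a)"
      using compl p a by simp
    show "\<sim> p \<otimes> \<sim> a = \<sim>\<^bsub>boolean_effect_monoid (effect_order (corner M (\<sim> p)))\<^esub> (\<sim> p \<otimes> a)"
      using B.compl_boolean_effect_monoid[OF in_q[OF a]] compl q a by simp
  next
    fix a b assume ab: "a \<in> carrier M" "b \<in> carrier M"
    \<comment> \<open>Boolean orthogonality is a meet equal to bottom, that is, a zero product;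
      \<open>B.orth_iff_mult_eq_zero\<close> identifies it with the relation inherited from
      \<open>M\<close>.\<close>
    have orth: "\<sim> p \<otimes> a \<perp>\<^bsub>boolean_effect_monoid (effect_order (corner M (\<sim> p)))\<^esub> \<sim> p \<otimes> b
        \<longleftrightarrow> \<sim> p \<otimes> a \<perp> \<sim> p \<otimes> b"
      using B.orth_iff_mult_eq_zero[OF in_q[OF ab(1)] in_q[OF ab(2)]]
        B.meet_effect_order[OF in_q[OF ab(1)] in_q[OF ab(2)]] B.bottom_effect_order
      by (simp add: boolean_effect_monoid_def)
    then show "a \<perp> b \<longleftrightarrow> p \<otimes> a \<perp> p \<otimes> b \<and>
        \<sim> p \<otimes> a \<perp>\<^bsub>boolean_effect_monoid (effect_order (corner M (\<sim> p)))\<^esub> \<sim> p \<otimes> b"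
      using orth_idem_split[of p a b] p ab by simp
    {
      assume "a \<perp> b"
      then show "p \<otimes> (a \<oplus> b) = p \<otimes> a \<oplus> p \<otimes> b"
        and "\<sim> p \<otimes> (a \<oplus> b) =
          \<sim> p \<otimes> a \<oplus>\<^bsub>boolean_effect_monoid (effect_order (corner M (\<sim> p)))\<^esub> \<sim> p \<otimes> b"
        using distrib_left p q ab B.plus_eq_join[OF in_q[OF ab(1)] in_q[OF ab(2)]]
        by (simp_all add: boolean_effect_monoid_def)
    }
    show "p \<otimes> (a \<otimes> b) = (p \<otimes> a) \<otimes> (p \<otimes> b)"
      using mult p ab by simp
    show "\<sim> p \<otimes> (a \<otimes> b) =
        (\<sim> p \<otimes> a) \<otimes>\<^bsub>boolean_effect_monoid (effect_order (corner M (\<sim> p)))\<^esub> (\<sim> p \<otimes> b)"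
      using mult[OF q ab] B.meet_effect_order[OF in_q[OF ab(1)] in_q[OF ab(2)]]
      by (simp add: boolean_effect_monoid_def)
  qed
  then show ?thesis
    unfolding effect_monoid_isomorphic_def by blast
qed

end

theorem theorem57:
  fixes M :: "'a effect_monoid"
  assumes "effect_monoid M" and "directed_complete M"
  shows "\<exists>(M1 :: 'a effect_monoid) (M2 :: 'a gorder).
    effect_monoid M1 \<and> convex_effect_algebra M1 \<and> directed_complete M1 \<and>
    complete_boolean_algebra M2 \<and>
    M \<cong> M1 \<oplus>\<oplus> boolean_effect_monoid M2"
proof -
  interpret effect_monoid M
    by (rule assms(1))
  obtain h where h: "h \<in> carrier M" "h \<perp>\<^bsub>M\<^esub> h"
    "(h \<oplus>\<^bsub>M\<^esub> h) \<otimes>\<^bsub>M\<^esub> (h \<oplus>\<^bsub>M\<^esub> h) = h \<oplus>\<^bsub>M\<^esub> h"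
    and greatest: "\<And>k. \<lbrakk>k \<in> carrier M; k \<perp>\<^bsub>M\<^esub> k\<rbrakk> \<Longrightarrow> k \<preceq>\<^bsub>M\<^esub> h"
    by (rule greatest_self_orth[OF assms(2)]) blast
  define p where "p = h \<oplus>\<^bsub>M\<^esub> h"
  let ?q = "\<sim>\<^bsub>M\<^esub> p"
  have p: "p \<in> carrier M" "p \<otimes>\<^bsub>M\<^esub> p = p"
    using h by (simp_all add: p_def)
  have q: "?q \<in> carrier M" "?q \<otimes>\<^bsub>M\<^esub> ?q = ?q"
    using p idem_compl by simp_all
  have hp: "h \<preceq>\<^bsub>M\<^esub> p"
    using h le_plus by (simp add: p_def)
  have "halvable_effect_monoid (corner M p) h"
    unfolding halvable_effect_monoid_def halvable_effect_monoid_axioms_def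
    using effect_monoid_corner[OF p] directed_complete_corner[OF assms(2) p] h hp
    by (simp add: corner_one[OF p(1)] flip: p_def)
  then have convex: "convex_effect_algebra (corner M p)"
    by (rule halvable_effect_monoid.convex_effect_algebra)
  have "a \<otimes>\<^bsub>M\<^esub> a = a" if a: "a \<in> carrier M" "a \<preceq>\<^bsub>M\<^esub> ?q" for a
  proof -
    let ?b = "a \<otimes>\<^bsub>M\<^esub> (\<sim>\<^bsub>M\<^esub> a)"
    have b: "?b \<in> carrier M"
      using a by simp
    have "?b \<preceq>\<^bsub>M\<^esub> \<sim>\<^bsub>M\<^esub> a"
      using a mult_le_right by simp
    moreover have ba: "?b \<preceq>\<^bsub>M\<^esub> a"
      using a mult_le_left by simp
    ultimately have "?b \<perp>\<^bsub>M\<^esub> ?b"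
      using plus_mono(1)[of ?b a ?b "\<sim>\<^bsub>M\<^esub> a"] a by simp
    then have "?b \<preceq>\<^bsub>M\<^esub> p"
      using greatest[OF b] le_trans[OF _ hp b] by simp
    moreover have "?b \<preceq>\<^bsub>M\<^esub> ?q"
      using ba a(2) b by (rule le_trans)
    \<comment> \<open>Being below both idempotents, \<open>?b\<close> is fixed by both, hence by
      their product, which is zero.\<close>
    ultimately have "p \<otimes>\<^bsub>M\<^esub> ?b = ?b" "?q \<otimes>\<^bsub>M\<^esub> ?b = ?b"
      using le_idem_iff p q b by blast+
    then have "?b = (p \<otimes>\<^bsub>M\<^esub> ?q) \<otimes>\<^bsub>M\<^esub> ?b"
      using p q b mult_assoc by simp
    then have "?b = \<zero>\<^bsub>M\<^esub>"
      using idem_iff[OF p(1)] p b by simp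
    then show ?thesis
      using idem_iff a by simp
  qed
  then have B: "idempotent_effect_monoid (corner M ?q)"
    unfolding idempotent_effect_monoid_def idempotent_effect_monoid_axioms_def
    using effect_monoid_corner[OF q] directed_complete_corner[OF assms(2) q] by simp
  show ?thesis
    using effect_monoid_corner[OF p] convex directed_complete_corner[OF assms(2) p]
      idempotent_effect_monoid.complete_boolean_algebra_effect_order[OF B]
      isomorphic_corner_sum[OF p B]
    by blast
qed

end
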